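(* Let $N\ge1$, $f:[N]\to\{0,1\}$, and suppose we are given a quantum $\varepsilon$-biased oracle $O^{\varepsilon}_f$ for $f$, with no prior knowledge of the value of $\varepsilon$. Then there exists a quantum algorithm that outputs a number $\tilde\varepsilon_{\min}$ satisfying $\varepsilon_{\min}/(5\pi^2)\le\tilde\varepsilon_{\min}\le\varepsilon_{\min}$ with probability at least $2/3$, and whose query complexity is expected to be $O\!\left(\frac{\sqrt{N}\log N}{\varepsilon_{\min}}\log\log\frac{1}{\varepsilon_{\min}}\right)$.
   Context: A quantum oracle of a Boolean function $f:[N]\to\{0,1\}$ with bias $\varepsilon$ (an $\varepsilon$-biased oracle) is a unitary transformation $O^{\varepsilon}_f$ (queries may use $O^{\varepsilon}_f$ or its inverse) such that for every $x\in[N]$, $O^{\varepsilon}_f\ket{x}\ket{0^{m-1}}\ket{0}=\ket{x}\big(\alpha_x\ket{w_x}\ket{f(x)}+\beta_x\ket{w'_x}\ket{\overline{f(x)}}\big)$, where $\ket{w_x},\ket{w'_x}$ are normalized work-register states and $|\alpha_x|^2=1/2+\varepsilon_x\ge 1/2+\varepsilon$, with $0<\varepsilon$. Define $\varepsilon_{\min}=\min_x\varepsilon_x$ (so $0<\varepsilon\le\varepsilon_{\min}\le\varepsilon_x\le1/2$). The query complexity is the number of applications of the oracle or its inverse. *)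

theory Defs
  imports "HOL-Analysis.Analysis" "HOL-Library.Extended_Nonnegative_Real"
begin

text \<open>Matrices and vectors over the complex numbers are represented as functions
on indices, together with an explicit dimension D (indices 0..D-1).\<close>

type_synonym cmat = "nat \<Rightarrow> nat \<Rightarrow> complex"
type_synonym cvec = "nat \<Rightarrow> complex"

definition mat_apply :: "nat \<Rightarrow> cmat \<Rightarrow> cvec \<Rightarrow> cvec" where
  "mat_apply D M v = (\<lambda>i. if i < D then (\<Sum>j<D. M i j * v j) else 0)"

definition mat_adj :: "cmat \<Rightarrow> cmat" where
  "mat_adj M = (\<lambda>i j. cnj (M j i))"

definition unitary_on :: "nat \<Rightarrow> cmat \<Rightarrow> bool" where
  "unitary_on D M \<longleftrightarrow>
     (\<forall>i<D. \<forall>k<D. (\<Sum>j<D. M i j * cnj (M k j)) = (if i = k then 1 else 0))"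

text \<open>Oracle register: basis states |x>|w>|b> with x < N, w < 2^(m-1), b < 2,
encoded as the index x * 2^m + 2 * w + b (dimension N * 2^m). The state
|x>|0^(m-1)>|0> has index x * 2^m.\<close>

definition oracle_dim :: "nat \<Rightarrow> nat \<Rightarrow> nat" where
  "oracle_dim N m = N * 2 ^ m"

text \<open>The squared amplitude |alpha_x|^2 of the correct answer f(x) in Or|x>|0>|0>.\<close>
definition alpha_sq :: "nat \<Rightarrow> (nat \<Rightarrow> bool) \<Rightarrow> cmat \<Rightarrow> nat \<Rightarrow> real" where
  "alpha_sq m f Or x =
     (\<Sum>w<2 ^ (m - 1). (cmod (Or (x * 2 ^ m + 2 * w + of_bool (f x)) (x * 2 ^ m)))\<^sup>2)"

definition eps_x :: "nat \<Rightarrow> (nat \<Rightarrow> bool) \<Rightarrow> cmat \<Rightarrow> nat \<Rightarrow> real" where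
  "eps_x m f Or x = alpha_sq m f Or x - 1 / 2"

definition eps_min :: "nat \<Rightarrow> nat \<Rightarrow> (nat \<Rightarrow> bool) \<Rightarrow> cmat \<Rightarrow> real" where
  "eps_min N m f Or = Min ((eps_x m f Or) ` {..<N})"

text \<open>Or is an epsilon-biased oracle for f : [N] -> {0,1} with an m-qubit
output/work register: a unitary on the oracle register that maps |x>|0>|0>
into |x> (tensor) (alpha_x |w_x>|f x> + beta_x |w'_x>|not f x>) with
|alpha_x|^2 >= 1/2 + epsilon.\<close>
definition biased_oracle ::
  "nat \<Rightarrow> nat \<Rightarrow> (nat \<Rightarrow> bool) \<Rightarrow> real \<Rightarrow> cmat \<Rightarrow> bool" where
  "biased_oracle N m f \<epsilon> Or \<longleftrightarrow>
     unitary_on (oracle_dim N m) Or \<and>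
     (\<forall>x<N. (\<forall>j<oracle_dim N m. j div 2 ^ m \<noteq> x \<longrightarrow> Or j (x * 2 ^ m) = 0) \<and>
            alpha_sq m f Or x \<ge> 1 / 2 + \<epsilon>)"

text \<open>Extension of an oracle-register operator to the oracle register tensored
with an ancilla register of dimension A (full index = j * A + a).\<close>
definition lift :: "nat \<Rightarrow> cmat \<Rightarrow> cmat" where
  "lift A M = (\<lambda>i k. if i mod A = k mod A then M (i div A) (k div A) else 0)"

datatype gate = Gate cmat | Query | QueryInv

text \<open>In each round the algorithm either stops with a real output, or runs a
circuit on a fresh register (oracle register tensored with an A-dimensional
ancilla) initialised to the basis state 0, and then measures everything in the
computational basis. The choice is made adaptively from the classical history
of all previous measurement outcomes.\<close>
datatype action = Output real | Circuit nat "gate list"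

type_synonym strategy = "nat list \<Rightarrow> action"

definition apply_gate :: "nat \<Rightarrow> nat \<Rightarrow> cmat \<Rightarrow> gate \<Rightarrow> cvec \<Rightarrow> cvec" where
  "apply_gate K A Or g v = (case g of
      Gate U \<Rightarrow> mat_apply (K * A) U v
    | Query \<Rightarrow> mat_apply (K * A) (lift A Or) v
    | QueryInv \<Rightarrow> mat_apply (K * A) (lift A (mat_adj Or)) v)"

definition run_circuit :: "nat \<Rightarrow> nat \<Rightarrow> cmat \<Rightarrow> gate list \<Rightarrow> cvec" where
  "run_circuit K A Or gs =
     fold (apply_gate K A Or) gs (\<lambda>i. if i = 0 then 1 else 0)"

definition num_queries :: "action \<Rightarrow> nat" where
  "num_queries a = (case a of Output _ \<Rightarrow> 0
     | Circuit A gs \<Rightarrow> length (filter (\<lambda>g. g = Query \<or> g = QueryInv) gs))"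

definition outcome_prob :: "nat \<Rightarrow> cmat \<Rightarrow> action \<Rightarrow> nat \<Rightarrow> real" where
  "outcome_prob K Or a i = (case a of Output _ \<Rightarrow> 0
     | Circuit A gs \<Rightarrow> (if i < K * A then (cmod (run_circuit K A Or gs i))\<^sup>2 else 0))"

definition hist_prob :: "strategy \<Rightarrow> nat \<Rightarrow> cmat \<Rightarrow> nat list \<Rightarrow> real" where
  "hist_prob alg K Or h = (\<Prod>k<length h. outcome_prob K Or (alg (take k h)) (h ! k))"

definition nn_sum :: "(nat list \<Rightarrow> ennreal) \<Rightarrow> ennreal" where
  "nn_sum g = (SUP F\<in>{F. finite F}. (\<Sum>h\<in>F. g h))"

definition success_prob :: "strategy \<Rightarrow> nat \<Rightarrow> cmat \<Rightarrow> (real \<Rightarrow> bool) \<Rightarrow> ennreal" where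
  "success_prob alg K Or P =
     nn_sum (\<lambda>h. case alg h of Output r \<Rightarrow> (if P r then ennreal (hist_prob alg K Or h) else 0)
                              | Circuit _ _ \<Rightarrow> 0)"

definition expected_queries :: "strategy \<Rightarrow> nat \<Rightarrow> cmat \<Rightarrow> ennreal" where
  "expected_queries alg K Or =
     nn_sum (\<lambda>h. ennreal (hist_prob alg K Or h * real (num_queries (alg h))))"

definition valid_strategy :: "strategy \<Rightarrow> nat \<Rightarrow> bool" where
  "valid_strategy alg K \<longleftrightarrow>
     (\<forall>h A gs. alg h = Circuit A gs \<longrightarrow>
        A \<ge> 1 \<and> (\<forall>U. Gate U \<in> set gs \<longrightarrow> unitary_on (K * A) U))"

end

theory Submission
  imports "Jordan_Normal_Form.Determinant" Defs
begin

text \<open>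
  For a basis state \<open>p\<close> in a set \<open>P\<close> and a flagged set \<open>F\<close>, the walk \<open>W\<close> (reflection about \<open>P\<close> times the flip
  of \<open>F\<close> conjugated by a circuit \<open>G\<close>) has the moments \<open>cos (k * \<psi> p)\<close> on \<open>P\<close>, where
  \<open>cos (\<psi> p) = 1 - 2 * s p\<close> and \<open>s p\<close> is the probability that \<open>G\<close> leads from \<open>p\<close> into \<open>F\<close>. Phase estimation with a
  clock register of \<open>r * L\<close> states and amplitudes taken from the \<open>r\<close>-th power of a Dirichlet kernel
  separates \<open>\<psi> \<le> 2 * pi / L\<close> from \<open>\<psi> \<ge> 8 * pi / L\<close> with error \<open>4 / 2 ^ r\<close>.

  This is used twice. The inner use takes \<open>G\<close> to be oracle, sign flip of the answer bit, inverse
  oracle; its return amplitude on input \<open>x\<close> is \<open>\<plusminus> 2 * eps_x\<close>, so that in superposition over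
  all \<open>x\<close> the inputs with \<open>eps_x \<le> 1 / L\<close> get flagged and those with \<open>eps_x \<ge> 2 * pi / L\<close> are flagged
  with probability \<open>O(1 / N)\<close> once \<open>r\<close> is of order \<open>log N\<close>. The outer use estimates the total flagged
  probability with a clock of order \<open>sqrt N\<close> and thus detects whether some input is flagged; this is
  Grover search that tolerates inputs in between. Round \<open>k\<close> does this for \<open>L = 2 ^ (k + 1)\<close> with error
  \<open>O(1 / k\<^sup>2)\<close>, at the price of a factor \<open>log k\<close>, which is \<open>log log (1 / eps_min)\<close> at the relevant rounds. The
  algorithm outputs \<open>1 / L\<close> in the first round that detects nothing.
\<close>

section \<open>Unitary matrices\<close>

text \<open>\<open>unitary_on\<close> asks for orthonormal rows. The columns are then orthonormal
  because a right inverse of a square matrix is also a left inverse, which is applied to the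
  corresponding matrices in \<open>carrier_mat\<close>.\<close>

lemma unitary_on_columns:
  assumes "unitary_on D M" "i < D" "k < D"
  shows "(\<Sum>j<D. cnj (M j i) * M j k) = (if i = k then 1 else 0)"
proof -
  define A where "A = Matrix.mat D D (\<lambda>(i, j). M i j)"
  define B where "B = Matrix.mat D D (\<lambda>(i, j). cnj (M j i))"
  have c: "A \<in> carrier_mat D D" "B \<in> carrier_mat D D"
    by (auto simp: A_def B_def)
  have "A * B = 1\<^sub>m D"
  proof (rule eq_matI)
    fix i k assume "i < dim_row (1\<^sub>m D)" "k < dim_col (1\<^sub>m D)"
    then show "(A * B) $$ (i, k) = (1\<^sub>m D) $$ (i, k)"
      using assms(1) by (simp add: A_def B_def scalar_prod_def unitary_on_def atLeast0LessThan)
  qed (auto simp: A_def B_def)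
  then have "B * A = 1\<^sub>m D"
    using c mat_mult_left_right_inverse by blast
  then have "(B * A) $$ (i, k) = (1\<^sub>m D) $$ (i, k)" by simp
  then show ?thesis
    using assms by (simp add: A_def B_def scalar_prod_def atLeast0LessThan)
qed

lemma unitary_on_mat_adj:
  assumes "unitary_on D M" shows "unitary_on D (mat_adj M)"
  using unitary_on_columns[OF assms] by (simp add: unitary_on_def mat_adj_def)

section \<open>Inner products and the action of matrices on vectors\<close>

definition ip :: "nat \<Rightarrow> cvec \<Rightarrow> cvec \<Rightarrow> complex" where
  "ip D u v = (\<Sum>i<D. cnj (u i) * v i)"

definition supported :: "nat \<Rightarrow> cvec \<Rightarrow> bool" where
  "supported D v \<longleftrightarrow> (\<forall>i\<ge>D. v i = 0)"

lemma ip_cong: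
  "(\<And>i. i < D \<Longrightarrow> u i = u' i) \<Longrightarrow> (\<And>i. i < D \<Longrightarrow> v i = v' i) \<Longrightarrow> ip D u v = ip D u' v'"
  unfolding ip_def by (intro sum.cong) auto

lemma ip_self: "ip D v v = of_real (\<Sum>i<D. (cmod (v i))\<^sup>2)"
  by (simp add: ip_def complex_norm_square mult.commute del: of_real_power)

lemma cnj_ip: "cnj (ip D u v) = ip D v u"
  by (simp add: ip_def mult.commute)

lemma ip_sum_right: "ip D u (\<lambda>i. \<Sum>s\<in>S. c s * v s i) = (\<Sum>s\<in>S. c s * ip D u (v s))"
  unfolding ip_def sum_distrib_left by (subst sum.swap) (simp add: mult_ac)

lemma ip_sum_left: "ip D (\<lambda>i. \<Sum>s\<in>S. c s * v s i) u = (\<Sum>s\<in>S. cnj (c s) * ip D (v s) u)"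
  unfolding ip_def sum_distrib_left cnj_sum sum_distrib_right by (subst sum.swap) (simp add: mult_ac)

lemma mat_apply_sum:
  "mat_apply D M (\<lambda>i. \<Sum>s\<in>S. c s * v s i) = (\<lambda>i. \<Sum>s\<in>S. c s * mat_apply D M (v s) i)"
proof
  fix i
  have "(\<Sum>j<D. M i j * (\<Sum>s\<in>S. c s * v s j)) = (\<Sum>s\<in>S. c s * (\<Sum>j<D. M i j * v s j))"
    unfolding sum_distrib_left by (subst sum.swap) (simp add: mult_ac)
  then show "mat_apply D M (\<lambda>i. \<Sum>s\<in>S. c s * v s i) i = (\<Sum>s\<in>S. c s * mat_apply D M (v s) i)"
    by (simp add: mat_apply_def)
qed

lemma supported_mat_apply [simp]: "supported D (mat_apply D M v)"
  by (simp add: supported_def mat_apply_def)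

lemma mat_apply_cong:
  "(\<And>i. i < D \<Longrightarrow> u i = v i) \<Longrightarrow> mat_apply D M u = mat_apply D M v"
  by (auto simp: mat_apply_def fun_eq_iff intro!: sum.cong)

lemma mat_adj_mat_adj [simp]: "mat_adj (mat_adj M) = M"
  by (simp add: mat_adj_def)

lemma mat_apply_adj_cancel:
  assumes "unitary_on D M" "supported D v"
  shows "mat_apply D (mat_adj M) (mat_apply D M v) = v"
proof
  fix i
  show "mat_apply D (mat_adj M) (mat_apply D M v) i = v i"
  proof (cases "i < D")
    case True
    have "(\<Sum>j<D. cnj (M j i) * (\<Sum>k<D. M j k * v k)) = (\<Sum>k<D. (\<Sum>j<D. cnj (M j i) * M j k) * v k)"
      unfolding sum_distrib_left sum_distrib_right by (subst sum.swap) (simp add: mult_ac)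
    also have "\<dots> = (\<Sum>k<D. (if i = k then 1 else 0) * v k)"
      by (intro sum.cong refl) (simp add: unitary_on_columns[OF assms(1) True])
    also have "\<dots> = v i" using True by (simp add: if_distrib [where f = "\<lambda>x. x * _"] cong: if_cong)
    finally show ?thesis using True by (simp add: mat_apply_def mat_adj_def)
  next
    case False
    then show ?thesis using assms(2) by (simp add: mat_apply_def supported_def)
  qed
qed

lemma ip_mat_apply_right: "ip D u (mat_apply D M v) = ip D (mat_apply D (mat_adj M) u) v"
  unfolding ip_def mat_apply_def mat_adj_def
  by (simp add: sum_distrib_left sum_distrib_right) (subst sum.swap, simp add: mult_ac)

lemma ip_mat_apply:
  assumes "unitary_on D M"
  shows "ip D (mat_apply D M u) (mat_apply D M v) = ip D u v"
proof -
  \<comment> \<open>Cancelling the adjoint requires a supported vector. Truncating \<open>u\<close>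
    to its first \<open>D\<close> entries provides one and changes neither side.\<close>
  define u' where "u' = (\<lambda>i. if i < D then u i else 0)"
  have "mat_apply D M u = mat_apply D M u'" by (rule mat_apply_cong) (simp add: u'_def)
  moreover have "supported D u'" by (simp add: supported_def u'_def)
  ultimately have "ip D (mat_apply D M u) (mat_apply D M v) = ip D u' v"
    by (simp add: ip_mat_apply_right mat_apply_adj_cancel[OF assms])
  also have "\<dots> = ip D u v" by (rule ip_cong) (simp_all add: u'_def)
  finally show ?thesis .
qed

section \<open>Diagonal, state preparation and Fourier matrices\<close>

definition diag_mat :: "(nat \<Rightarrow> complex) \<Rightarrow> cmat" where
  "diag_mat d = (\<lambda>i j. if i = j then d i else 0)"

lemma mat_apply_diag_mat:
  "mat_apply D (diag_mat d) v = (\<lambda>i. if i < D then d i * v i else 0)"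
  by (auto simp: mat_apply_def diag_mat_def fun_eq_iff if_distrib [where f = "\<lambda>x. x * _"] cong: if_cong)

lemma unitary_on_diag_mat:
  "(\<And>i. cmod (d i) = 1) \<Longrightarrow> unitary_on D (diag_mat d)"
  by (auto simp: unitary_on_def diag_mat_def if_distrib [where f = "\<lambda>x. x * _"] complex_norm_square[symmetric] cong: if_cong)

text \<open>The Householder reflection exchanging the first basis vector and the unit vector \<open>a\<close>; for
  \<open>a 0 = 1\<close> the division by zero makes it the identity, which is what is needed.\<close>
definition prep_mat :: "(nat \<Rightarrow> real) \<Rightarrow> cmat" where
  "prep_mat a = (\<lambda>i j. of_real ((if i = j then 1 else 0) -
     ((if i = 0 then 1 else 0) - a i) * ((if j = 0 then 1 else 0) - a j) / (1 - a 0)))"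

text \<open>In a product register of index \<open>i * T + t\<close> the ancilla is the low-order
  digit; this split factors it off in every sum over the enlarged register.\<close>

lemma sum_upt_split:
  fixes f :: "nat \<Rightarrow> 'a::comm_monoid_add"
  shows "(\<Sum>j<D * T. f j) = (\<Sum>i<D. \<Sum>t<T. f (i * T + t))"
proof -
  have "(\<Sum>j<D * T. f j) = (\<Sum>i<D. sum f {i * T..<i * T + T})" by (simp add: sum.nat_group)
  also have "\<dots> = (\<Sum>i<D. \<Sum>t<T. f (i * T + t))"
  proof (rule sum.cong[OF refl])
    fix i
    show "sum f {i * T..<i * T + T} = (\<Sum>t<T. f (i * T + t))"
      using sum.shift_bounds_nat_ivl[of f 0 "i * T" T]
      by (simp add: atLeast0LessThan add.commute)
  qed
  finally show ?thesis .
qed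

text \<open>With \<open>u\<close> the first basis vector minus \<open>a\<close>, the norm condition
  gives \<open>|u|^2 = 2 * (1 - a 0)\<close>. This lets the quadratic term in the product of two
  rows cancel both linear terms, and it forces \<open>u = 0\<close> below \<open>D\<close> when
  \<open>a 0 = 1\<close>.\<close>

lemma prep_mat_unit:
  assumes "D > 0" and n: "(\<Sum>i<D. (a i)\<^sup>2) = 1"
  shows "unitary_on D (prep_mat a)" and "i < D \<Longrightarrow> prep_mat a i 0 = of_real (a i)"
proof -
  define e where "e = (\<lambda>i::nat. if i = 0 then 1 else 0 :: real)"
  define u where "u i = e i - a i" for i
  define c where "c = 1 - a 0"
  have eu: "(\<Sum>i<D. e i * g i) = g 0" for g :: "nat \<Rightarrow> real"
    using \<open>D > 0\<close> by (simp add: e_def if_distrib [where f = "\<lambda>x. x * _"] cong: if_cong)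
  have "(u i)\<^sup>2 = e i * e i - 2 * (e i * a i) + (a i)\<^sup>2" for i
    by (simp add: u_def power2_eq_square algebra_simps)
  then have uu: "(\<Sum>i<D. (u i)\<^sup>2) = 2 * c"
    using n eu[of e] eu[of a]
    by (simp add: sum.distrib sum_subtractf sum_distrib_left[symmetric] c_def) (simp add: e_def)
  have P: "prep_mat a i j = of_real ((if i = j then 1 else 0) - u i * u j / c)" for i j
    by (simp add: prep_mat_def u_def e_def c_def)
  have c0: "u i = 0" if "c = 0" "i < D" for i
    using uu that sum_nonneg_eq_0_iff[of "{..<D}" "\<lambda>i. (u i)\<^sup>2"] by simp
  show "unitary_on D (prep_mat a)"
    unfolding unitary_on_def
  proof (intro allI impI)
    fix i k assume ik: "i < D" "k < D"
    let ?d = "\<lambda>i j. if i = j then 1 else (0::real)"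
    have "(\<Sum>j<D. (?d i j - u i * u j / c) * (?d k j - u k * u j / c)) =
       (\<Sum>j<D. ?d i j * ?d k j - ?d i j * (u k * u j / c) - ?d k j * (u i * u j / c) + (u i * u k / c\<^sup>2) * (u j)\<^sup>2)"
      by (intro sum.cong refl) (simp add: left_diff_distrib right_diff_distrib power2_eq_square algebra_simps)
    also have "\<dots> = (\<Sum>j<D. ?d i j * ?d k j) - (\<Sum>j<D. ?d i j * (u k * u j / c))
        - (\<Sum>j<D. ?d k j * (u i * u j / c)) + (u i * u k / c\<^sup>2) * (\<Sum>j<D. (u j)\<^sup>2)"
      by (simp only: sum.distrib sum_subtractf sum_distrib_left)
    also have "\<dots> = ?d i k - u k * u i / c - u i * u k / c + (u i * u k / c\<^sup>2) * (2 * c)"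
    proof -
      have d: "(\<Sum>j<D. ?d i j * g j) = g i" if "i < D" for i and g :: "nat \<Rightarrow> real"
        using that by (simp add: if_distrib [where f = "\<lambda>x. x * _"] cong: if_cong)
      have "?d k i = ?d i k" by simp
      then show ?thesis
        by (simp only: d[OF ik(1)] d[OF ik(2)] uu)
    qed
    also have "\<dots> = ?d i k" by (simp add: power2_eq_square)
    finally have *: "(\<Sum>j<D. (?d i j - u i * u j / c) * (?d k j - u k * u j / c)) = ?d i k" .
    have "(\<Sum>j<D. prep_mat a i j * cnj (prep_mat a k j)) =
       of_real (\<Sum>j<D. (?d i j - u i * u j / c) * (?d k j - u k * u j / c))"
      by (simp add: P del: of_real_diff)
    also have "\<dots> = (if i = k then 1 else 0)" unfolding * by simp
    finally show "(\<Sum>j<D. prep_mat a i j * cnj (prep_mat a k j)) = (if i = k then 1 else 0)" .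
  qed
  show "prep_mat a i 0 = of_real (a i)" if "i < D"
  proof (cases "c = 0")
    case True
    then show ?thesis using c0[OF True that] unfolding P by (auto simp: u_def e_def)
  next
    case False
    then have "u 0 / c = 1" by (simp add: u_def e_def c_def)
    then have "u i * u 0 / c = u i" using False by simp
    then show ?thesis unfolding P by (auto simp: u_def e_def)
  qed
qed

text \<open>The negative sign is that of the read-out in phase estimation: clock phases
  \<open>cis (t * psi)\<close> become a peak at \<open>j\<close> near
  \<open>T * psi / (2 * pi)\<close> modulo \<open>T\<close>.\<close>

definition fourier_mat :: "nat \<Rightarrow> cmat" where
  "fourier_mat T = (\<lambda>j t. cis (- 2 * pi * real j * real t / real T) / of_real (sqrt (real T)))"

text \<open>Products of rows are geometric sums in a \<open>T\<close>-th root of unity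
  \<open>z\<close>. If \<open>z = 1\<close>, then \<open>k - i\<close> is a multiple of
  \<open>T\<close> of absolute value below \<open>T\<close>, hence 0.\<close>

lemma unitary_on_fourier_mat: "unitary_on T (fourier_mat T)"
  unfolding unitary_on_def
proof (intro allI impI)
  fix i k assume ik: "i < T" "k < T"
  then have T: "T > 0" by simp
  define z where "z = cis (2 * pi * (real k - real i) / real T)"
  have "fourier_mat T i j * cnj (fourier_mat T k j) = z ^ j / of_nat T" for j
  proof -
    have "cis (- 2 * pi * real i * real j / real T) * cis (2 * pi * real k * real j / real T) = z ^ j"
      unfolding z_def Complex.DeMoivre cis_mult by (rule arg_cong[where f = cis]) (simp add: diff_divide_distrib algebra_simps)
    moreover have "complex_of_real (sqrt (real T)) * of_real (sqrt (real T)) = of_nat T"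
      by (metis of_real_mult of_real_of_nat_eq of_nat_0_le_iff real_sqrt_mult_self abs_of_nonneg)
    ultimately show ?thesis by (simp add: fourier_mat_def cis_cnj)
  qed
  then have eq: "(\<Sum>j<T. fourier_mat T i j * cnj (fourier_mat T k j)) = (\<Sum>j<T. z ^ j) / of_nat T"
    by (simp add: sum_divide_distrib)
  show "(\<Sum>j<T. fourier_mat T i j * cnj (fourier_mat T k j)) = (if i = k then 1 else 0)"
  proof (cases "i = k")
    case True
    then show ?thesis unfolding eq using T by (simp add: z_def)
  next
    case False
    have "z \<noteq> 1"
    proof
      assume "z = 1"
      then have "cos (2 * pi * (real k - real i) / real T) = 1" unfolding z_def by (metis cis.simps(1) one_complex.simps(1))
      then obtain n :: int where "2 * pi * (real k - real i) / real T = real_of_int n * 2 * pi"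
        unfolding cos_one_2pi_int by blast
      then have "2 * pi * (real k - real i) = 2 * pi * (real_of_int n * real T)"
        using T by (simp add: field_simps)
      then have "real_of_int (int k - int i) = real_of_int (n * int T)" by simp
      then have e: "int k - int i = n * int T" by linarith
      have "\<bar>int k - int i\<bar> < int T" using ik by linarith
      then have "n = 0" unfolding e abs_mult using T by (cases "n = 0") (auto simp: zero_less_abs_iff)
      then show False using e False by simp
    qed
    moreover have "z ^ T = 1"
    proof -
      have "z ^ T = cis (2 * pi * of_int (int k - int i))"
        unfolding z_def Complex.DeMoivre using T by simp
      also have "\<dots> = 1" by (rule cis_multiple_2pi) simp
      finally show ?thesis .
    qed
    ultimately show ?thesis unfolding eq using False by (simp add: geometric_sum)
  qed
qed

section \<open>Circuits and slices of the ancilla register\<close>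

text \<open>Because two successive ancillas amount to one of the product dimension,
  \<open>lift_gate\<close> can leave \<open>Query\<close> and \<open>QueryInv\<close> as they
  are.\<close>

lemma lift_lift: "lift T (lift A M) = lift (A * T) M"
proof (intro ext)
  fix i k
  have "(i mod T = k mod T \<and> i div T mod A = k div T mod A) \<longleftrightarrow> i mod (T * A) = k mod (T * A)"
  proof
    assume e: "i mod (T * A) = k mod (T * A)"
    then have m: "i mod T = k mod T" by (metis mod_mod_cancel dvd_triv_left)
    with e have "T * (i div T mod A) = T * (k div T mod A)" by (simp add: mod_mult2_eq)
    then show "i mod T = k mod T \<and> i div T mod A = k div T mod A"
      using m by (cases "T = 0") auto
  qed (simp add: mod_mult2_eq)
  then show "lift T (lift A M) i k = lift (A * T) M i k"
    by (auto simp: lift_def div_mult2_eq mult.commute[of A T])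
qed

lemma index_lt: "i < D \<Longrightarrow> t < T \<Longrightarrow> i * T + t < D * (T::nat)"
proof -
  assume "i < D" "t < T"
  then have "i * T + t < Suc i * T" by simp
  also have "\<dots> \<le> D * T" using \<open>i < D\<close> by (intro mult_le_mono1) simp
  finally show ?thesis .
qed

lemma lift_at: "s < T \<Longrightarrow> t < T \<Longrightarrow> lift T M (i * T + s) (k * T + t) = (if s = t then M i k else 0)"
  by (simp add: lift_def)

lemma unitary_on_lift:
  assumes "unitary_on D M" shows "unitary_on (D * T) (lift T M)"
  unfolding unitary_on_def
proof (intro allI impI)
  fix i k assume ik: "i < D * T" "k < D * T"
  then have T: "T > 0" by (cases T) auto
  have d: "i div T < D" "k div T < D" using ik by (auto simp: less_mult_imp_div_less)
  have "(\<Sum>j<D * T. lift T M i j * cnj (lift T M k j)) =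
     (\<Sum>j<D. \<Sum>t<T. if t = i mod T \<and> t = k mod T then M (i div T) j * cnj (M (k div T) j) else 0)"
    unfolding sum_upt_split by (intro sum.cong refl) (auto simp: lift_def)
  also have "\<dots> = (\<Sum>j<D. if i mod T = k mod T then M (i div T) j * cnj (M (k div T) j) else 0)"
  proof (intro sum.cong refl)
    fix j
    have "(\<Sum>t<T. if t = i mod T \<and> t = k mod T then M (i div T) j * cnj (M (k div T) j) else 0) =
       (\<Sum>t<T. if t = i mod T then (if i mod T = k mod T then M (i div T) j * cnj (M (k div T) j) else 0) else 0)"
      by (intro sum.cong refl) auto
    also have "\<dots> = (if i mod T = k mod T then M (i div T) j * cnj (M (k div T) j) else 0)"
      using T by simp
    finally show "(\<Sum>t<T. if t = i mod T \<and> t = k mod T then M (i div T) j * cnj (M (k div T) j) else 0) =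
      (if i mod T = k mod T then M (i div T) j * cnj (M (k div T) j) else 0)" .
  qed
  also have "\<dots> = (if i mod T = k mod T then (if i div T = k div T then 1 else 0) else 0)"
    using assms d by (auto simp: unitary_on_def)
  also have "\<dots> = (if i = k then 1 else 0)" by (metis div_mod_decomp)
  finally show "(\<Sum>j<D * T. lift T M i j * cnj (lift T M k j)) = (if i = k then 1 else 0)" .
qed

section \<open>Operators on the ancilla, and slices at a fixed clock value\<close>

definition anc :: "nat \<Rightarrow> cmat \<Rightarrow> cmat" where
  "anc T M = (\<lambda>i k. if i div T = k div T then M (i mod T) (k mod T) else 0)"

lemma unitary_on_anc:
  assumes "unitary_on T M" shows "unitary_on (D * T) (anc T M)"
  unfolding unitary_on_def
proof (intro allI impI)
  fix i k assume ik: "i < D * T" "k < D * T"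
  then have T: "T > 0" by (cases T) auto
  have d: "i div T < D" "k div T < D" using ik by (auto simp: less_mult_imp_div_less)
  have "(\<Sum>j<D * T. anc T M i j * cnj (anc T M k j)) =
     (\<Sum>j<D. if j = i div T then (if i div T = k div T then \<Sum>t<T. M (i mod T) t * cnj (M (k mod T) t) else 0) else 0)"
    unfolding sum_upt_split by (intro sum.cong refl) (auto simp: anc_def)
  also have "\<dots> = (if i div T = k div T then (if i mod T = k mod T then 1 else 0) else 0)"
    using assms d T by (simp add: unitary_on_def)
  also have "\<dots> = (if i = k then 1 else 0)" by (metis div_mod_decomp)
  finally show "(\<Sum>j<D * T. anc T M i j * cnj (anc T M k j)) = (if i = k then 1 else 0)" .
qed

text \<open>The component of a state at clock value \<open>t\<close>. Slices reduce operations on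
  the enlarged register to operations on the original one.\<close>

definition slice :: "nat \<Rightarrow> nat \<Rightarrow> cvec \<Rightarrow> cvec" where
  "slice T t v = (\<lambda>i. v (i * T + t))"

lemma supported_slice:
  assumes "supported (D * T) v" "t < T" shows "supported D (slice T t v)"
  unfolding supported_def
proof (intro allI impI)
  fix i assume "D \<le> i"
  then have "D * T \<le> i * T + t" by (meson mult_le_mono1 trans_le_add1)
  then show "slice T t v i = 0" using assms by (simp add: supported_def slice_def)
qed

lemma not_index_lt: "\<not> i < D \<Longrightarrow> \<not> i * T + t < D * (T::nat)"
  by (meson mult_le_mono1 not_le trans_le_add1)

lemma slice_lift:
  assumes t: "t < T"
  shows "slice T t (mat_apply (D * T) (lift T M) v) = mat_apply D M (slice T t v)"
proof
  fix i
  show "slice T t (mat_apply (D * T) (lift T M) v) i = mat_apply D M (slice T t v) i"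
  proof (cases "i < D")
    case True
    have "(\<Sum>j<D * T. lift T M (i * T + t) j * v j) = (\<Sum>j<D. \<Sum>s<T. if s = t then M i j * v (j * T + t) else 0)"
      unfolding sum_upt_split using t by (intro sum.cong refl) (auto simp: lift_at)
    also have "\<dots> = (\<Sum>j<D. M i j * v (j * T + t))" using t by simp
    finally show ?thesis using True t by (simp add: mat_apply_def slice_def index_lt)
  next
    case False
    then show ?thesis using not_index_lt[OF False] by (simp add: mat_apply_def slice_def)
  qed
qed

lemma slice_anc:
  assumes t: "t < T"
  shows "slice T t (mat_apply (D * T) (anc T M) v) =
    (\<lambda>i. if i < D then \<Sum>s<T. M t s * slice T s v i else 0)"
proof
  fix i
  show "slice T t (mat_apply (D * T) (anc T M) v) i = (if i < D then \<Sum>s<T. M t s * slice T s v i else 0)"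
  proof (cases "i < D")
    case True
    have "(\<Sum>j<D * T. anc T M (i * T + t) j * v j) = (\<Sum>j<D. if j = i then \<Sum>s<T. M t s * v (i * T + s) else 0)"
      unfolding sum_upt_split using t by (intro sum.cong refl) (auto simp: anc_def)
    also have "\<dots> = (\<Sum>s<T. M t s * v (i * T + s))" using True by simp
    finally show ?thesis using True t by (simp add: mat_apply_def slice_def index_lt)
  next
    case False
    then show ?thesis using not_index_lt[OF False] by (simp add: mat_apply_def slice_def)
  qed
qed

definition flip_mat :: "nat set \<Rightarrow> cmat" where
  "flip_mat S = diag_mat (\<lambda>n. if n \<in> S then -1 else 1)"

definition ctrl_flip :: "nat \<Rightarrow> nat \<Rightarrow> nat set \<Rightarrow> cmat" where
  "ctrl_flip T s S = diag_mat (\<lambda>n. if s < n mod T \<and> n div T \<in> S then -1 else 1)"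

lemma unitary_on_flip_mat: "unitary_on D (flip_mat S)"
  unfolding flip_mat_def by (rule unitary_on_diag_mat) simp

lemma unitary_on_ctrl_flip: "unitary_on D (ctrl_flip T s S)"
  unfolding ctrl_flip_def by (rule unitary_on_diag_mat) simp

lemma slice_ctrl_flip:
  assumes "t < T" "supported (D * T) v"
  shows "slice T t (mat_apply (D * T) (ctrl_flip T s S) v) =
    (if s < t then mat_apply D (flip_mat S) (slice T t v) else slice T t v)"
proof
  fix i
  show "slice T t (mat_apply (D * T) (ctrl_flip T s S) v) i =
    (if s < t then mat_apply D (flip_mat S) (slice T t v) else slice T t v) i"
    using assms index_lt[of i D t T] not_index_lt[of i D T t]
    by (cases "i < D") (auto simp: ctrl_flip_def flip_mat_def mat_apply_diag_mat slice_def supported_def)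
qed

section \<open>Adjoints, lifting and query counts of circuits\<close>

fun adj_gate :: "gate \<Rightarrow> gate" where
  "adj_gate (Gate U) = Gate (mat_adj U)"
| "adj_gate Query = QueryInv"
| "adj_gate QueryInv = Query"

definition adj_circ :: "gate list \<Rightarrow> gate list" where
  "adj_circ gs = rev (map adj_gate gs)"

fun lift_gate :: "nat \<Rightarrow> gate \<Rightarrow> gate" where
  "lift_gate T (Gate U) = Gate (lift T U)"
| "lift_gate T Query = Query"
| "lift_gate T QueryInv = QueryInv"

definition valid_circ :: "nat \<Rightarrow> gate list \<Rightarrow> bool" where
  "valid_circ D gs \<longleftrightarrow> (\<forall>U. Gate U \<in> set gs \<longrightarrow> unitary_on D U)"

definition count_queries :: "gate list \<Rightarrow> nat" where
  "count_queries gs = length (filter (\<lambda>g. g = Query \<or> g = QueryInv) gs)"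

lemma count_queries_simps [simp]:
  "count_queries [] = 0" "count_queries (Gate U # gs) = count_queries gs"
  "count_queries (Query # gs) = Suc (count_queries gs)"
  "count_queries (QueryInv # gs) = Suc (count_queries gs)"
  "count_queries (xs @ ys) = count_queries xs + count_queries ys"
  by (simp_all add: count_queries_def)

lemma adj_gate_adj_gate [simp]: "adj_gate (adj_gate g) = g"
  by (cases g) auto

lemma adj_circ_adj_circ [simp]: "adj_circ (adj_circ gs) = gs"
  by (simp add: adj_circ_def rev_map o_def)

lemma count_queries_lift [simp]: "count_queries (map (lift_gate T) gs) = count_queries gs"
proof (induction gs)
  case (Cons g gs) then show ?case by (cases g) auto
qed simp

lemma count_queries_adj [simp]: "count_queries (adj_circ gs) = count_queries gs"
proof (induction gs)
  case (Cons g gs) then show ?case by (cases g) (auto simp: adj_circ_def)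
qed (simp add: adj_circ_def)

lemma valid_circ_simps [simp]:
  "valid_circ D []" "valid_circ D (Gate U # gs) \<longleftrightarrow> unitary_on D U \<and> valid_circ D gs"
  "valid_circ D (Query # gs) \<longleftrightarrow> valid_circ D gs"
  "valid_circ D (QueryInv # gs) \<longleftrightarrow> valid_circ D gs"
  "valid_circ D (xs @ ys) \<longleftrightarrow> valid_circ D xs \<and> valid_circ D ys"
  by (auto simp: valid_circ_def)

lemma valid_circ_lift: "valid_circ D gs \<Longrightarrow> valid_circ (D * T) (map (lift_gate T) gs)"
proof (induction gs)
  case (Cons g gs) then show ?case by (cases g) (auto simp: unitary_on_lift)
qed simp

lemma valid_circ_adj: "valid_circ D gs \<Longrightarrow> valid_circ D (adj_circ gs)"
proof (induction gs)
  case (Cons g gs) then show ?case by (cases g) (auto simp: unitary_on_mat_adj adj_circ_def)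
qed (simp add: adj_circ_def)

definition walk_circ :: "gate list \<Rightarrow> nat set \<Rightarrow> nat set \<Rightarrow> gate list" where
  "walk_circ gs F P = gs @ [Gate (flip_mat F)] @ adj_circ gs @ [Gate (flip_mat (- P))]"

text \<open>Only the two sign flips are controlled by the clock register; on the branches where they are
  switched off the circuit and its adjoint cancel.\<close>
definition ctrl_walk :: "nat \<Rightarrow> gate list \<Rightarrow> nat set \<Rightarrow> nat set \<Rightarrow> nat \<Rightarrow> gate list" where
  "ctrl_walk T gs F P s = map (lift_gate T) gs @ [Gate (ctrl_flip T s F)] @
     map (lift_gate T) (adj_circ gs) @ [Gate (ctrl_flip T s (- P))]"

text \<open>Amplitude estimation with the controlled powers in unary form: the walk with index
  \<open>s\<close> is active at clock values above \<open>s\<close>, so the \<open>T\<close> of them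
  together apply \<open>t\<close> walk steps at clock value \<open>t\<close>. The clock starts with
  amplitudes \<open>a\<close> and is read in the Fourier basis.\<close>

definition amp_est ::
  "nat \<Rightarrow> (nat \<Rightarrow> real) \<Rightarrow> gate list \<Rightarrow> gate list \<Rightarrow> nat set \<Rightarrow> nat set \<Rightarrow> gate list" where
  "amp_est T a gs0 gs F P = map (lift_gate T) gs0 @ [Gate (anc T (prep_mat a))] @
     concat (map (ctrl_walk T gs F P) [0..<T]) @ [Gate (anc T (fourier_mat T))]"

lemma valid_circ_walk: "valid_circ D gs \<Longrightarrow> valid_circ D (walk_circ gs F P)"
  by (simp add: walk_circ_def valid_circ_adj unitary_on_flip_mat)

lemma valid_circ_ctrl_walk: "valid_circ D gs \<Longrightarrow> valid_circ (D * T) (ctrl_walk T gs F P s)"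
  by (simp add: ctrl_walk_def valid_circ_adj valid_circ_lift unitary_on_ctrl_flip)

lemma valid_circ_concat: "(\<And>x. x \<in> set xs \<Longrightarrow> valid_circ D (f x)) \<Longrightarrow> valid_circ D (concat (map f xs))"
  by (induction xs) auto

lemma valid_circ_amp_est:
  assumes "valid_circ D gs0" "valid_circ D gs" "T > 0" "(\<Sum>i<T. (a i)\<^sup>2) = 1"
  shows "valid_circ (D * T) (amp_est T a gs0 gs F P)"
  using assms unfolding amp_est_def
  by (simp add: valid_circ_lift unitary_on_anc prep_mat_unit unitary_on_fourier_mat
      valid_circ_concat valid_circ_ctrl_walk)

text \<open>Each of the \<open>T\<close> controlled walks runs \<open>gs\<close> and its adjoint
  whatever the clock shows.\<close>

lemma count_queries_amp_est:
  "count_queries (amp_est T a gs0 gs F P) = count_queries gs0 + 2 * T * count_queries gs"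
proof -
  have "count_queries (concat (map (ctrl_walk T gs F P) xs)) = 2 * length xs * count_queries gs" for xs
    by (induction xs) (auto simp: ctrl_walk_def)
  from this[of "[0..<T]"] show ?thesis by (simp add: amp_est_def)
qed

definition gate_mat :: "nat \<Rightarrow> cmat \<Rightarrow> gate \<Rightarrow> cmat" where
  "gate_mat A Or g = (case g of Gate U \<Rightarrow> U | Query \<Rightarrow> lift A Or | QueryInv \<Rightarrow> lift A (mat_adj Or))"

lemma apply_gate_eq: "apply_gate K A Or g v = mat_apply (K * A) (gate_mat A Or g) v"
  by (cases g) (simp_all add: apply_gate_def gate_mat_def)

lemma gate_mat_adj: "gate_mat A Or (adj_gate g) = mat_adj (gate_mat A Or g)"
  by (cases g) (auto simp: gate_mat_def lift_def mat_adj_def fun_eq_iff)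

lemma gate_mat_lift: "gate_mat (A * T) Or (lift_gate T g) = lift T (gate_mat A Or g)"
  by (cases g) (auto simp: gate_mat_def lift_lift)

definition basis :: "nat \<Rightarrow> cvec" where
  "basis p = (\<lambda>i. if i = p then 1 else 0)"

lemma supported_basis: "p < D \<Longrightarrow> supported D (basis p)"
  by (auto simp: supported_def basis_def)

lemma ip_basis_left: "p < D \<Longrightarrow> ip D (basis p) v = v p"
  by (simp add: ip_def basis_def if_distrib [where f = "\<lambda>x. x * _"] if_distrib [where f = cnj] cong: if_cong)

section \<open>Action of circuits on states\<close>

locale unitary_oracle =
  fixes K :: nat and Or :: cmat
  assumes unitary: "unitary_on K Or"
begin

definition run :: "nat \<Rightarrow> gate list \<Rightarrow> cvec \<Rightarrow> cvec" where
  "run A gs v = fold (apply_gate K A Or) gs v"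

lemma run_Nil [simp]: "run A [] v = v"
  and run_Cons: "run A (g # gs) v = run A gs (mat_apply (K * A) (gate_mat A Or g) v)"
  and run_append [simp]: "run A (xs @ ys) v = run A ys (run A xs v)"
  and run_Gate [simp]: "run A (Gate U # gs) v = run A gs (mat_apply (K * A) U v)"
  by (simp_all add: run_def apply_gate_eq gate_mat_def)

lemma run_circuit_eq: "run_circuit K A Or gs = run A gs (basis 0)"
  by (simp add: run_circuit_def run_def basis_def)

lemma unitary_gate_mat:
  assumes "valid_circ (K * A) (g # gs)" shows "unitary_on (K * A) (gate_mat A Or g)"
  using assms by (cases g) (auto simp: gate_mat_def unitary_on_lift unitary_on_mat_adj unitary)

lemma valid_circ_ConsD: "valid_circ D (g # gs) \<Longrightarrow> valid_circ D gs"
  by (simp add: valid_circ_def)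

lemma run_sum: "run A gs (\<lambda>i. \<Sum>s\<in>S. c s * v s i) = (\<lambda>i. \<Sum>s\<in>S. c s * run A gs (v s) i)"
  by (induction gs arbitrary: v) (simp_all add: run_Cons mat_apply_sum)

lemma run_lin2: "run A gs (\<lambda>i. a * u i - v i) = (\<lambda>i. a * run A gs u i - run A gs v i)"
  using run_sum[of A gs "\<lambda>b. if b then a else - 1" "\<lambda>b. if b then u else v" UNIV]
  by (simp add: UNIV_bool)

lemma run_scale: "run A gs (\<lambda>i. a * u i) = (\<lambda>i. a * run A gs u i)"
  using run_sum[of A gs "\<lambda>b. a" "\<lambda>b. u" "{True}"] by simp

lemma supported_run: "supported (K * A) v \<Longrightarrow> supported (K * A) (run A gs v)"
  by (induction gs arbitrary: v) (simp_all add: run_Cons)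

lemma ip_run: "valid_circ (K * A) gs \<Longrightarrow> ip (K * A) (run A gs u) (run A gs v) = ip (K * A) u v"
proof (induction gs arbitrary: u v)
  case (Cons g gs)
  then show ?case
    by (simp add: run_Cons ip_mat_apply[OF unitary_gate_mat[OF Cons.prems]] valid_circ_ConsD[OF Cons.prems])
qed simp

lemma run_adj_cancel:
  "valid_circ (K * A) gs \<Longrightarrow> supported (K * A) v \<Longrightarrow> run A (adj_circ gs) (run A gs v) = v"
proof (induction gs arbitrary: v)
  case (Cons g gs)
  have "run A (adj_circ (g # gs)) (run A (g # gs) v) =
      mat_apply (K * A) (mat_adj (gate_mat A Or g)) (run A (adj_circ gs) (run A gs (mat_apply (K * A) (gate_mat A Or g) v)))"
    by (simp add: adj_circ_def run_Cons gate_mat_adj)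
  also have "\<dots> = v"
    by (simp add: Cons.IH valid_circ_ConsD[OF Cons.prems(1)]
        mat_apply_adj_cancel[OF unitary_gate_mat[OF Cons.prems(1)] Cons.prems(2)])
  finally show ?case .
qed (simp add: adj_circ_def)

lemma run_adj_cancel':
  "valid_circ (K * A) gs \<Longrightarrow> supported (K * A) v \<Longrightarrow> run A gs (run A (adj_circ gs) v) = v"
  using run_adj_cancel[of A "adj_circ gs" v] by (simp add: valid_circ_adj)

lemma ip_run_adj:
  assumes "valid_circ (K * A) gs" "supported (K * A) v"
  shows "ip (K * A) u (run A (adj_circ gs) v) = ip (K * A) (run A gs u) v"
  using ip_run[OF assms(1), of u "run A (adj_circ gs) v"] by (simp add: run_adj_cancel'[OF assms])

lemma slice_run_lift:
  "t < T \<Longrightarrow> slice T t (run (A * T) (map (lift_gate T) gs) v) = run A gs (slice T t v)"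
proof (induction gs arbitrary: v)
  case (Cons g gs)
  have "K * (A * T) = K * A * T" by simp
  then have "slice T t (mat_apply (K * (A * T)) (lift T (gate_mat A Or g)) v) = mat_apply (K * A) (gate_mat A Or g) (slice T t v)"
    by (metis slice_lift Cons.prems)
  then show ?case using Cons by (simp add: run_Cons gate_mat_lift)
qed simp

lemma slice_ctrl_walk:
  assumes "t < T" "supported (K * A * T) v" "valid_circ (K * A) gs"
  shows "slice T t (run (A * T) (ctrl_walk T gs F P s) v) =
    (if s < t then run A (walk_circ gs F P) (slice T t v) else slice T t v)"
proof -
  have e: "K * (A * T) = K * A * T" by simp
  have "supported (K * A * T) (run (A * T) gs' v')" if "supported (K * A * T) v'" for gs' v'
    using supported_run[of "A * T"] that unfolding e by blast
  with assms show ?thesis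
    by (auto simp: ctrl_walk_def walk_circ_def slice_run_lift slice_ctrl_flip e
        run_adj_cancel supported_slice)
qed

text \<open>Step \<open>s\<close> acts at clock value \<open>t\<close> only if \<open>s < t\<close>,
  so \<open>n\<close> steps have the effect of \<open>min t n\<close> walks; for
  \<open>n = T\<close> this is \<open>t\<close>.\<close>

lemma slice_ctrl_walks:
  assumes "t < T" "supported (K * A * T) v" "valid_circ (K * A) gs"
  shows "slice T t (run (A * T) (concat (map (ctrl_walk T gs F P) [0..<n])) v) =
    (run A (walk_circ gs F P) ^^ min t n) (slice T t v)"
proof (induction n)
  case (Suc n)
  have e: "K * (A * T) = K * A * T" by simp
  have "supported (K * A * T) (run (A * T) (concat (map (ctrl_walk T gs F P) [0..<n])) v)"
    using supported_run[of "A * T"] assms(2) unfolding e by blast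
  from slice_ctrl_walk[OF assms(1) this assms(3)] Suc show ?case
    by (auto simp: min_def le_Suc_eq not_le less_Suc_eq)
qed simp

end

section \<open>Moments of the walk\<close>

text \<open>The probability of the clock reading \<open>j\<close> if every walk step merely
  multiplied the state by the phase \<open>cis \<psi>\<close>.\<close>

definition kern :: "nat \<Rightarrow> (nat \<Rightarrow> real) \<Rightarrow> nat \<Rightarrow> real \<Rightarrow> real" where
  "kern T a j \<psi> = (cmod (\<Sum>t<T. fourier_mat T j t * of_real (a t) * cis (real t * \<psi>)))\<^sup>2"

text \<open>The moments \<open>cos (k * \<psi>)\<close> are those of an equal mixture of the phases
  \<open>\<psi>\<close> and \<open>- \<psi>\<close>. Expanding both squares, the exponentials add up
  to twice a cosine.\<close>

lemma kern_symmetrised: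
  "complex_of_real ((kern T a j \<psi> + kern T a j (- \<psi>)) / 2) =
   (\<Sum>s<T. \<Sum>t<T. cnj (fourier_mat T j s * of_real (a s)) * (fourier_mat T j t * of_real (a t)) *
      of_real (cos ((real s - real t) * \<psi>)))"
proof -
  define b where "b t = fourier_mat T j t * of_real (a t)" for t
  have k: "complex_of_real (kern T a j \<phi>) = (\<Sum>s<T. \<Sum>t<T. cnj (b s) * b t * cis ((real t - real s) * \<phi>))" for \<phi>
  proof -
    have "complex_of_real (kern T a j \<phi>) = cnj (\<Sum>t<T. b t * cis (real t * \<phi>)) * (\<Sum>t<T. b t * cis (real t * \<phi>))"
      unfolding kern_def b_def complex_norm_square by (simp only: mult.commute)
    also have "\<dots> = (\<Sum>s<T. \<Sum>t<T. cnj (b s * cis (real s * \<phi>)) * (b t * cis (real t * \<phi>)))"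
      by (simp only: cnj_sum sum_product)
    also have "\<dots> = (\<Sum>s<T. \<Sum>t<T. cnj (b s) * b t * (cis (- (real s * \<phi>)) * cis (real t * \<phi>)))"
      by (simp add: cis_cnj mult_ac)
    also have "\<dots> = (\<Sum>s<T. \<Sum>t<T. cnj (b s) * b t * cis ((real t - real s) * \<phi>))"
      unfolding cis_mult by (simp add: algebra_simps)
    finally show ?thesis .
  qed
  have c: "cis ((real t - real s) * \<psi>) + cis ((real t - real s) * - \<psi>) = 2 * of_real (cos ((real s - real t) * \<psi>))" for s t
  proof -
    have "cos ((real s - real t) * \<psi>) = cos ((real t - real s) * \<psi>)"
      using cos_minus[of "(real s - real t) * \<psi>"] by (simp add: algebra_simps)
    then show ?thesis by (simp add: complex_eq_iff)
  qed
  have "complex_of_real ((kern T a j \<psi> + kern T a j (- \<psi>)) / 2) =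
      (\<Sum>s<T. \<Sum>t<T. cnj (b s) * b t * (cis ((real t - real s) * \<psi>) + cis ((real t - real s) * - \<psi>))) / 2"
    by (simp only: of_real_divide of_real_add k sum.distrib distrib_left of_real_numeral)
  also have "\<dots> = (\<Sum>s<T. \<Sum>t<T. cnj (b s) * b t * of_real (cos ((real s - real t) * \<psi>)))"
    unfolding c sum_divide_distrib by (simp add: mult.assoc)
  finally show ?thesis by (simp add: b_def)
qed

context unitary_oracle
begin

lemma run_funpow: "run A gs ^^ k = run A (concat (replicate k gs))"
proof (induction k)
  case (Suc k)
  show ?case unfolding funpow_Suc_right Suc.IH by (simp add: fun_eq_iff)
qed (simp add: fun_eq_iff)

text \<open>The vector \<open>f = basis p\<close> satisfies \<open>W f = 2 cos \<psi> f - U f\<close> and \<open>W (U f) = f\<close>, where \<open>U\<close> is the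
  conjugated flip; hence the powers of \<open>W\<close> obey the Chebyshev recurrence on \<open>f\<close>.\<close>
lemma walk_recurrence:
  assumes gs: "valid_circ (K * A) gs" and P: "P \<subseteq> {..<K * A}" and p: "p \<in> P"
    and orth: "\<And>q. q \<in> P \<Longrightarrow>
      (\<Sum>n\<in>{..<K * A} \<inter> F. cnj (run A gs (basis q) n) * run A gs (basis p) n) = (if q = p then of_real s else 0)"
    and psi: "cos \<psi> = 1 - 2 * s"
  defines "W \<equiv> run A (walk_circ gs F P)"
  shows "q \<in> P \<Longrightarrow> ip (K * A) (basis q) (W (basis p)) = (if q = p then of_real (cos \<psi>) else 0)"
    and "(W ^^ Suc (Suc k)) (basis p) = (\<lambda>i. of_real (2 * cos \<psi>) * (W ^^ Suc k) (basis p) i - (W ^^ k) (basis p) i)"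
proof -
  define D where "D = K * A"
  define fl where "fl S v = mat_apply D (flip_mat S) v" for S v
  define U where "U v = run A (adj_circ gs) (fl F (run A gs v))" for v
  have fl: "fl S v i = (if i < D then (if i \<in> S then - v i else v i) else 0)" for S v i
    by (simp add: fl_def flip_mat_def mat_apply_diag_mat)
  have supp: "supported D (fl S v)" for S v by (simp add: fl_def)
  have W: "W v = fl (- P) (U v)" for v
    by (simp add: W_def walk_circ_def U_def fl_def D_def)
  have pD: "p < D" using p P by (auto simp: D_def)
  have suppU: "supported D (U v)" for v unfolding U_def D_def
    by (rule supported_run) (use supp in \<open>simp add: D_def\<close>)
  have flfl: "fl S (fl S v) = v" if "supported D v" for S v
    using that by (auto simp: fl fun_eq_iff supported_def)
  have UU: "U (U v) = v" if "supported D v" for v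
  proof -
    have "run A gs (U v) = fl F (run A gs v)"
      unfolding U_def by (rule run_adj_cancel'[OF gs]) (use supp in \<open>simp add: D_def\<close>)
    then have "U (U v) = run A (adj_circ gs) (run A gs v)"
      using flfl[of "run A gs v" F] supported_run[of A v gs] that by (simp add: U_def D_def)
    then show ?thesis using run_adj_cancel[OF gs] that by (simp add: D_def)
  qed
  \<comment> \<open>The flip of \<open>F\<close> is the identity minus twice the projection onto
    \<open>F\<close>, so on \<open>P\<close> the entries of \<open>U\<close> are the Kronecker delta
    minus twice the flagged overlaps.\<close>
  have Up: "U (basis p) q = (if q = p then of_real (cos \<psi>) else 0)" if q: "q \<in> P" for q
  proof -
    have qD: "q < D" using q P by (auto simp: D_def)
    let ?u = "run A gs (basis q)" and ?v = "run A gs (basis p)"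
    have "U (basis p) q = ip D (basis q) (U (basis p))" by (simp add: ip_basis_left qD)
    also have "\<dots> = ip D ?u (fl F ?v)"
      unfolding U_def D_def by (rule ip_run_adj[OF gs]) (use supp in \<open>simp add: D_def\<close>)
    also have "\<dots> = (\<Sum>n<D. cnj (?u n) * ?v n - 2 * (if n \<in> F then cnj (?u n) * ?v n else 0))"
      unfolding ip_def by (intro sum.cong refl) (simp add: fl)
    also have "\<dots> = ip D ?u ?v - 2 * (\<Sum>n\<in>{..<D} \<inter> F. cnj (?u n) * ?v n)"
      by (simp add: sum_subtractf sum_distrib_left[symmetric] ip_def sum.inter_restrict)
    also have "\<dots> = (if q = p then 1 else 0) - 2 * (if q = p then of_real s else 0)"
      using orth[OF q] ip_run[OF gs, of "basis q" "basis p"] qD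
      by (simp add: D_def[symmetric] ip_basis_left) (simp add: basis_def)
    also have "\<dots> = (if q = p then of_real (cos \<psi>) else 0)"
      unfolding psi by simp
    finally show ?thesis .
  qed
  show "ip (K * A) (basis q) (W (basis p)) = (if q = p then of_real (cos \<psi>) else 0)" if q: "q \<in> P" for q
  proof -
    have "q < D" using q P by (auto simp: D_def)
    then show ?thesis using q by (simp add: D_def[symmetric] ip_basis_left W fl Up)
  qed
  \<comment> \<open>Off \<open>P\<close> the last flip turns \<open>U f\<close> into its negative;
    on \<open>P\<close> the vector \<open>U f\<close> equals \<open>cos \<psi>\<close> times
    \<open>f\<close>, so both sides agree there as well.\<close>
  have Wp: "W (basis p) = (\<lambda>i. of_real (2 * cos \<psi>) * basis p i - U (basis p) i)"
  proof
    fix i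
    show "W (basis p) i = of_real (2 * cos \<psi>) * basis p i - U (basis p) i"
      using Up[of i] P suppU[of "basis p"] pD p
      by (cases "i < D"; cases "i \<in> P") (auto simp: W fl supported_def basis_def D_def)
  qed
  \<comment> \<open>\<open>U\<close> is an involution, and the last flip fixes
    \<open>basis p\<close> as \<open>p\<close> lies in \<open>P\<close>.\<close>
  have WU: "W (U (basis p)) = basis p"
    using UU[OF supported_basis[OF pD]] p pD by (auto simp: W fl basis_def fun_eq_iff)
  have pow: "W ^^ k = run A (concat (replicate k (walk_circ gs F P)))" for k
    unfolding W_def by (rule run_funpow)
  have "(W ^^ Suc (Suc k)) (basis p) = (W ^^ Suc k) (W (basis p))"
    by (simp only: funpow_Suc_right o_apply)
  also have "\<dots> = (\<lambda>i. of_real (2 * cos \<psi>) * (W ^^ Suc k) (basis p) i - (W ^^ Suc k) (U (basis p)) i)"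
    unfolding Wp pow run_lin2 ..
  also have "(W ^^ Suc k) (U (basis p)) = (W ^^ k) (basis p)"
    by (simp only: funpow_Suc_right o_apply WU)
  finally show "(W ^^ Suc (Suc k)) (basis p) =
    (\<lambda>i. of_real (2 * cos \<psi>) * (W ^^ Suc k) (basis p) i - (W ^^ k) (basis p) i)" .
qed

text \<open>The cosines satisfy the same recurrence as the powers of the walk, with the same two
  initial values.\<close>

lemma walk_moment:
  assumes gs: "valid_circ (K * A) gs" and P: "P \<subseteq> {..<K * A}" and p: "p \<in> P" and q: "q \<in> P"
    and orth: "\<And>q. q \<in> P \<Longrightarrow>
      (\<Sum>n\<in>{..<K * A} \<inter> F. cnj (run A gs (basis q) n) * run A gs (basis p) n) = (if q = p then of_real s else 0)"
    and psi: "cos \<psi> = 1 - 2 * s"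
  defines "W \<equiv> run A (walk_circ gs F P)"
  shows "ip (K * A) (basis q) ((W ^^ k) (basis p)) = (if q = p then of_real (cos (real k * \<psi>)) else 0)"
proof (induction k rule: induct_nat_012)
  case 0
  have "q < K * A" using q P by auto
  then show ?case by (simp add: ip_basis_left) (simp add: basis_def)
next
  case 1
  then show ?case using walk_recurrence(1)[OF gs P p orth psi q] by (simp add: W_def)
next
  case (ge2 k)
  have qD: "q < K * A" using q P by auto
  have "cos (real (Suc (Suc k)) * \<psi>) = 2 * cos \<psi> * cos (real (Suc k) * \<psi>) - cos (real k * \<psi>)"
  proof -
    have "cos (real (Suc (Suc k)) * \<psi>) + cos (real k * \<psi>) = 2 * cos \<psi> * cos (real (Suc k) * \<psi>)"
      using cos_add[of "real (Suc k) * \<psi>" \<psi>] cos_diff[of "real (Suc k) * \<psi>" \<psi>]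
      by (simp add: algebra_simps)
    then show ?thesis by simp
  qed
  moreover have "(W ^^ Suc (Suc k)) (basis p) =
      (\<lambda>i. of_real (2 * cos \<psi>) * (W ^^ Suc k) (basis p) i - (W ^^ k) (basis p) i)"
    unfolding W_def by (rule walk_recurrence(2)[OF gs P p orth psi])
  ultimately show ?case
    using ge2 by (simp only: ip_basis_left[OF qD]) simp
qed

text \<open>The walk preserves inner products, so only the difference of the exponents counts. Cross
  terms between different states of \<open>P\<close> vanish by \<open>walk_moment\<close>, and the
  superposition behaves like a classical mixture with weights \<open>|c p|^2\<close>.\<close>

lemma walk_moment_mixture:
  fixes c :: "nat \<Rightarrow> complex"
  assumes gs: "valid_circ (K * A) gs" and P: "P \<subseteq> {..<K * A}"
    and orth: "\<And>p q. p \<in> P \<Longrightarrow> q \<in> P \<Longrightarrow>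
      (\<Sum>n\<in>{..<K * A} \<inter> F. cnj (run A gs (basis q) n) * run A gs (basis p) n) = (if q = p then of_real (s p) else 0)"
    and psi: "\<And>p. p \<in> P \<Longrightarrow> cos (\<psi> p) = 1 - 2 * s p"
  defines "W \<equiv> run A (walk_circ gs F P)"
  defines "v0 \<equiv> \<lambda>i. \<Sum>p\<in>P. c p * basis p i"
  shows "ip (K * A) ((W ^^ i) v0) ((W ^^ j) v0) =
    of_real (\<Sum>p\<in>P. (cmod (c p))\<^sup>2 * cos ((real i - real j) * \<psi> p))"
proof -
  have fin: "finite P" using P finite_subset by blast
  have pow: "W ^^ k = run A (concat (replicate k (walk_circ gs F P)))" for k
    unfolding W_def by (rule run_funpow)
  have val: "valid_circ (K * A) (concat (replicate k (walk_circ gs F P)))" for k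
    by (induction k) (simp_all add: valid_circ_walk gs)
  have ord: "ip (K * A) ((W ^^ i) v0) ((W ^^ j) v0) =
    of_real (\<Sum>p\<in>P. (cmod (c p))\<^sup>2 * cos ((real i - real j) * \<psi> p))" if "i \<le> j" for i j
  proof -
    have "(W ^^ j) v0 = (W ^^ i) ((W ^^ (j - i)) v0)"
      using funpow_add[of i "j - i" W] that by (simp add: fun_eq_iff)
    then have "ip (K * A) ((W ^^ i) v0) ((W ^^ j) v0) = ip (K * A) v0 ((W ^^ (j - i)) v0)"
      unfolding pow by (simp add: ip_run val)
    also have "\<dots> = (\<Sum>q\<in>P. cnj (c q) * (\<Sum>p\<in>P. c p * ip (K * A) (basis q) ((W ^^ (j - i)) (basis p))))"
      unfolding v0_def pow run_sum ip_sum_left ip_sum_right ..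
    also have "\<dots> = (\<Sum>q\<in>P. cnj (c q) * (\<Sum>p\<in>P. c p * (if q = p then of_real (cos (real (j - i) * \<psi> p)) else 0)))"
      unfolding W_def by (intro sum.cong refl arg_cong2[where f = "(*)"]) (simp add: walk_moment[OF gs P _ _ orth psi])
    also have "\<dots> = (\<Sum>q\<in>P. cnj (c q) * (c q * of_real (cos (real (j - i) * \<psi> q))))"
      using fin by (simp add: if_distrib [where f = "\<lambda>x. _ * x"] cong: if_cong)
    also have "\<dots> = (\<Sum>q\<in>P. of_real ((cmod (c q))\<^sup>2 * cos ((real i - real j) * \<psi> q)))"
    proof (intro sum.cong refl)
      fix q
      have "cos (real (j - i) * \<psi> q) = cos ((real i - real j) * \<psi> q)"
        using cos_minus[of "real (j - i) * \<psi> q"] that by (simp add: of_nat_diff algebra_simps)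
      then show "cnj (c q) * (c q * of_real (cos (real (j - i) * \<psi> q))) =
          of_real ((cmod (c q))\<^sup>2 * cos ((real i - real j) * \<psi> q))"
        by (simp add: complex_norm_square mult_ac del: of_real_power)
    qed
    finally show ?thesis by simp
  qed
  \<comment> \<open>The remaining order of the exponents follows by conjugation: the value is real
    and the cosine is even.\<close>
  show ?thesis
  proof (cases "i \<le> j")
    case False
    then have "ip (K * A) ((W ^^ j) v0) ((W ^^ i) v0) =
      of_real (\<Sum>p\<in>P. (cmod (c p))\<^sup>2 * cos ((real j - real i) * \<psi> p))" by (intro ord) simp
    moreover have "cos ((real j - real i) * \<psi> p) = cos ((real i - real j) * \<psi> p)" for p
      using cos_minus[of "(real j - real i) * \<psi> p"] by (simp add: algebra_simps)
    ultimately have "ip (K * A) ((W ^^ j) v0) ((W ^^ i) v0) =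
      of_real (\<Sum>p\<in>P. (cmod (c p))\<^sup>2 * cos ((real i - real j) * \<psi> p))" by simp
    then show ?thesis
      using cnj_ip[of "K * A" "(W ^^ j) v0" "(W ^^ i) v0"] by (simp del: of_real_sum)
  qed (rule ord)
qed

text \<open>Before the Fourier transform the slice at clock value \<open>t\<close> is
  \<open>a t\<close> times the \<open>t\<close>-th iterate of the walk. The squared norm of slice
  \<open>j\<close> afterwards is a quadratic form in the moments of the walk, which
  \<open>kern_symmetrised\<close> recognises as an average of two kernels.\<close>

lemma amp_est_outcome:
  assumes gs: "valid_circ (K * A) gs" and gs0: "valid_circ (K * A) gs0" and P: "P \<subseteq> {..<K * A}"
    and orth: "\<And>p q. p \<in> P \<Longrightarrow> q \<in> P \<Longrightarrow>
      (\<Sum>n\<in>{..<K * A} \<inter> F. cnj (run A gs (basis q) n) * run A gs (basis p) n) = (if q = p then of_real (s p) else 0)"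
    and psi: "\<And>p. p \<in> P \<Longrightarrow> cos (\<psi> p) = 1 - 2 * s p"
    and init: "run A gs0 (basis 0) = (\<lambda>i. \<Sum>p\<in>P. c p * basis p i)"
    and KA: "K * A > 0" and a: "(\<Sum>t<T. (a t)\<^sup>2) = 1" and j: "j < T"
  shows "(\<Sum>i<K * A. (cmod (run_circuit K (A * T) Or (amp_est T a gs0 gs F P) (i * T + j)))\<^sup>2) =
    (\<Sum>p\<in>P. (cmod (c p))\<^sup>2 * ((kern T a j (\<psi> p) + kern T a j (- \<psi> p)) / 2))"
proof -
  define D where "D = K * A"
  have T: "T > 0" using j by simp
  have e: "K * (A * T) = D * T" by (simp add: D_def)
  define W where "W = run A (walk_circ gs F P)"
  define v0 where "v0 = run A gs0 (basis 0)"
  define v1 where "v1 = run (A * T) (map (lift_gate T) gs0) (basis 0)"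
  define v2 where "v2 = mat_apply (D * T) (anc T (prep_mat a)) v1"
  define v3 where "v3 = run (A * T) (concat (map (ctrl_walk T gs F P) [0..<T])) v2"
  have supp0: "supported D v0"
    unfolding v0_def D_def by (rule supported_run[OF supported_basis]) (use KA in simp)
  have s1: "slice T t v1 = (if t = 0 then v0 else (\<lambda>i. 0))" if "t < T" for t
  proof -
    \<comment> \<open>The zero vector is written as a multiple of \<open>basis 0\<close> so that
      \<open>run_scale\<close> covers the empty slices.\<close>
    have "slice T t (basis 0) = (if t = 0 then basis 0 else (\<lambda>i. 0 * basis 0 i))"
      using T by (auto simp: slice_def basis_def fun_eq_iff)
    then show ?thesis
      unfolding v1_def slice_run_lift[OF that] using run_scale[of A gs0 0] by (simp add: v0_def)
  qed
  have s2: "slice T t v2 = (\<lambda>i. of_real (a t) * v0 i)" if "t < T" for t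
  proof
    fix i
    have "(\<Sum>s<T. prep_mat a t s * slice T s v1 i) = (\<Sum>s<T. if s = 0 then prep_mat a t 0 * v0 i else 0)"
      by (intro sum.cong refl) (auto simp: s1)
    also have "\<dots> = of_real (a t) * v0 i" using T prep_mat_unit(2)[OF T a that] by simp
    finally show "slice T t v2 i = of_real (a t) * v0 i"
      using supp0 unfolding v2_def slice_anc[OF that] by (auto simp: supported_def)
  qed
  have supp2: "supported (D * T) v2" by (simp add: v2_def)
  have pow: "W ^^ k = run A (concat (replicate k (walk_circ gs F P)))" for k
    unfolding W_def by (rule run_funpow)
  have s3: "slice T t v3 = (\<lambda>i. of_real (a t) * (W ^^ t) v0 i)" if t: "t < T" for t
  proof -
    have "slice T t v3 = (W ^^ t) (slice T t v2)"
      using slice_ctrl_walks[OF t _ gs, of v2 F P T] supp2 t by (simp add: v3_def W_def D_def)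
    then show ?thesis by (simp add: s2[OF t] pow run_scale)
  qed
  define b where "b t = fourier_mat T j t * of_real (a t)" for t
  have "slice T j (run_circuit K (A * T) Or (amp_est T a gs0 gs F P)) =
     slice T j (mat_apply (D * T) (anc T (fourier_mat T)) v3)"
    by (simp add: run_circuit_eq amp_est_def v3_def v2_def v1_def e)
  also have "\<dots> = (\<lambda>i. if i < D then \<Sum>t<T. b t * (W ^^ t) v0 i else 0)"
    unfolding slice_anc[OF j] b_def by (auto simp: fun_eq_iff s3 mult_ac intro!: sum.cong)
  finally have fin: "run_circuit K (A * T) Or (amp_est T a gs0 gs F P) (i * T + j) =
     (if i < D then \<Sum>t<T. b t * (W ^^ t) v0 i else 0)" for i
    by (metis slice_def)
  let ?x = "\<lambda>i. \<Sum>t<T. b t * (W ^^ t) v0 i"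
  have "complex_of_real (\<Sum>i<D. (cmod (run_circuit K (A * T) Or (amp_est T a gs0 gs F P) (i * T + j)))\<^sup>2) =
     ip D ?x ?x"
    unfolding ip_self fin by simp
  also have "\<dots> = (\<Sum>s<T. cnj (b s) * (\<Sum>t<T. b t * ip D ((W ^^ s) v0) ((W ^^ t) v0)))"
    unfolding ip_sum_left ip_sum_right ..
  also have "\<dots> = (\<Sum>s<T. cnj (b s) * (\<Sum>t<T. b t * of_real (\<Sum>p\<in>P. (cmod (c p))\<^sup>2 * cos ((real s - real t) * \<psi> p))))"
  proof -
    have "ip D ((W ^^ s) v0) ((W ^^ t) v0) =
        of_real (\<Sum>p\<in>P. (cmod (c p))\<^sup>2 * cos ((real s - real t) * \<psi> p))" for s t
      unfolding D_def W_def v0_def init by (rule walk_moment_mixture[OF gs P orth psi])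
    then show ?thesis by simp
  qed
  also have "\<dots> = (\<Sum>s<T. \<Sum>t<T. \<Sum>p\<in>P. of_real ((cmod (c p))\<^sup>2) * (cnj (b s) * b t * of_real (cos ((real s - real t) * \<psi> p))))"
    by (simp add: sum_distrib_left mult_ac)
  also have "\<dots> = (\<Sum>p\<in>P. \<Sum>s<T. \<Sum>t<T. of_real ((cmod (c p))\<^sup>2) * (cnj (b s) * b t * of_real (cos ((real s - real t) * \<psi> p))))"
    by (subst sum.swap[of _ _ P], subst sum.swap[of _ P]) simp
  also have "\<dots> = (\<Sum>p\<in>P. of_real ((cmod (c p))\<^sup>2) * complex_of_real ((kern T a j (\<psi> p) + kern T a j (- \<psi> p)) / 2))"
    unfolding kern_symmetrised b_def sum_distrib_left ..
  also have "\<dots> = complex_of_real (\<Sum>p\<in>P. (cmod (c p))\<^sup>2 * ((kern T a j (\<psi> p) + kern T a j (- \<psi> p)) / 2))"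
    by simp
  finally show ?thesis unfolding D_def by (simp only: of_real_eq_iff)
qed

end

section \<open>The phase estimation kernel\<close>

text \<open>Jordan's inequality: the sine is concave on \<open>[0, pi]\<close> and thus lies above
  its chord from 0 to \<open>pi / 2\<close>.\<close>

lemma sin_ge_linear:
  fixes x :: real
  assumes "0 \<le> x" "x \<le> pi / 2"
  shows "2 * x / pi \<le> sin x"
proof -
  have "convex_on {0..pi} (\<lambda>x. - sin x :: real)"
    by (rule f''_ge0_imp_convex[where f' = "\<lambda>x. - cos x" and f'' = "\<lambda>x. sin x"])
      (auto intro!: derivative_eq_intros sin_ge_zero)
  then have "- sin ((1 - 2 * x / pi) *\<^sub>R 0 + (2 * x / pi) *\<^sub>R (pi / 2)) \<le>
      (1 - 2 * x / pi) * (- sin 0) + (2 * x / pi) * (- sin (pi / 2))"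
    by (rule convex_onD) (use assms in \<open>auto simp: field_simps\<close>)
  then show ?thesis by simp
qed

lemma sin_ge_min:
  fixes x :: real
  assumes "0 \<le> x" "x \<le> pi" "c \<le> 2 * x / pi" "c \<le> 2 * (pi - x) / pi"
  shows "c \<le> sin x"
proof (cases "x \<le> pi / 2")
  case True
  then show ?thesis using sin_ge_linear[of x] assms by simp
next
  case False
  then have "2 * (pi - x) / pi \<le> sin (pi - x)" using assms by (intro sin_ge_linear) auto
  then show ?thesis using assms by simp
qed

lemma cmod_cis_minus_1: "cmod (cis u - 1) = 2 * \<bar>sin (u / 2)\<bar>"
proof -
  have "(cmod (cis u - 1))\<^sup>2 = (cos u - 1)\<^sup>2 + (sin u)\<^sup>2" by (simp add: cmod_power2)
  also have "\<dots> = 2 - 2 * cos u" using sin_cos_squared_add[of u] by (simp add: power2_eq_square algebra_simps)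
  also have "\<dots> = (2 * sin (u / 2))\<^sup>2"
    using cos_double_sin[of "u / 2"] by (simp add: power_mult_distrib)
  finally show ?thesis by (metis abs_mult abs_norm_cancel abs_numeral power2_eq_iff_nonneg abs_ge_zero norm_ge_zero power2_abs)
qed

section \<open>Clock amplitudes from powers of the Dirichlet kernel\<close>

definition dirichlet :: "nat \<Rightarrow> 'a::comm_ring_1 poly" where
  "dirichlet L = (\<Sum>i<L. monom 1 i)"

text \<open>The clock amplitudes are the normalised coefficients of the \<open>r\<close>-th power of a Dirichlet
  kernel: their Fourier transform decays like the \<open>r\<close>-th power of \<open>1 / (L sin (u / 2))\<close>.\<close>
definition taper :: "nat \<Rightarrow> nat \<Rightarrow> nat \<Rightarrow> real" where
  "taper r L t = coeff (dirichlet L ^ r) t / sqrt (\<Sum>s<r * L. (coeff (dirichlet L ^ r) s)\<^sup>2)"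

lemma degree_dirichlet_power:
  assumes "L > 0" "r > 0"
  shows "degree (dirichlet L ^ r :: 'a::comm_ring_1 poly) < r * L"
proof -
  have "degree (dirichlet L :: 'a poly) \<le> L - 1"
    unfolding dirichlet_def by (rule degree_sum_le) (auto intro!: degree_monom_le[THEN le_trans])
  then have "degree (dirichlet L ^ r :: 'a poly) \<le> (L - 1) * r"
    using degree_power_le[of "dirichlet L :: 'a poly" r] by (meson le_trans mult_le_mono1)
  also have "\<dots> < r * L" using assms by (simp add: mult.commute)
  finally show ?thesis .
qed

lemma coeff_dirichlet_power_of_real:
  "coeff (dirichlet L ^ r :: complex poly) t = of_real (coeff (dirichlet L ^ r :: real poly) t)"
proof (induction r arbitrary: t)
  case 0
  show ?case by (simp add: coeff_1)
next
  case (Suc r)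
  have "coeff (dirichlet L :: complex poly) i = of_real (coeff (dirichlet L :: real poly) i)" for i
    by (simp add: dirichlet_def coeff_sum if_distrib cong: if_cong)
  then show ?case by (simp add: coeff_mult Suc)
qed

lemma sum_coeff_dirichlet_power:
  fixes z :: "'a::comm_ring_1"
  assumes "L > 0" "r > 0"
  shows "(\<Sum>t<r * L. coeff (dirichlet L ^ r) t * z ^ t) = (\<Sum>i<L. z ^ i) ^ r"
proof -
  have "(\<Sum>t<r * L. coeff (dirichlet L ^ r) t * z ^ t) = (\<Sum>t\<le>degree (dirichlet L ^ r :: 'a poly). coeff (dirichlet L ^ r) t * z ^ t)"
    using degree_dirichlet_power[OF assms, where 'a = 'a]
    by (intro sum.mono_neutral_right) (auto simp: coeff_eq_0)
  also have "\<dots> = poly (dirichlet L ^ r) z" by (simp add: poly_altdef)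
  also have "\<dots> = (\<Sum>i<L. z ^ i) ^ r" by (simp add: dirichlet_def poly_sum poly_monom)
  finally show ?thesis .
qed

text \<open>Cauchy-Schwarz for the \<open>r * L\<close> coefficients, whose sum is the value
  \<open>L ^ r\<close> of the polynomial at 1.\<close>

lemma sum_coeff_sq_ge:
  assumes "L > 0" "r > 0"
  shows "real L ^ (2 * r) \<le> real (r * L) * (\<Sum>s<r * L. (coeff (dirichlet L ^ r :: real poly) s)\<^sup>2)"
proof -
  have "(\<Sum>s<r * L. coeff (dirichlet L ^ r :: real poly) s) = real L ^ r"
    using sum_coeff_dirichlet_power[OF assms, of "1::real"] by simp
  then show ?thesis
    using sum_squared_le_sum_of_squares[of "\<lambda>s. coeff (dirichlet L ^ r :: real poly) s" "{..<r * L}"]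
    by (simp add: power_mult[symmetric] mult.commute)
qed

lemma sum_coeff_sq_pos:
  assumes "L > 0" "r > 0"
  shows "0 < (\<Sum>s<r * L. (coeff (dirichlet L ^ r :: real poly) s)\<^sup>2)"
proof -
  have "0 < real L ^ (2 * r)" using assms by simp
  with sum_coeff_sq_ge[OF assms] have "0 < real (r * L) * (\<Sum>s<r * L. (coeff (dirichlet L ^ r :: real poly) s)\<^sup>2)"
    by linarith
  then show ?thesis by (rule zero_less_mult_pos) (use assms in simp)
qed

lemma sum_taper_sq:
  assumes "L > 0" "r > 0" shows "(\<Sum>t<r * L. (taper r L t)\<^sup>2) = 1"
  using sum_coeff_sq_pos[OF assms] by (simp add: taper_def power_divide sum_divide_distrib[symmetric])

text \<open>The Fourier sum is the \<open>r\<close>-th power of a geometric sum in \<open>z\<close>,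
  which is at most \<open>2 / |z - 1|\<close> and hence at most \<open>1 / \<sigma>\<close>. The two
  normalisations contribute the divisor \<open>T * S\<close>, which is at least
  \<open>L ^ (2 * r)\<close> by \<open>sum_coeff_sq_ge\<close>.\<close>

lemma kern_taper_le:
  assumes L: "L > 0" and r: "r > 0" and \<sigma>: "0 < \<sigma>" "\<sigma> \<le> \<bar>sin (pi * real j / real (r * L) - \<psi> / 2)\<bar>"
  shows "kern (r * L) (taper r L) j \<psi> \<le> (1 / (real L * \<sigma>)) ^ (2 * r)"
proof -
  define T where "T = r * L"
  define S where "S = (\<Sum>s<T. (coeff (dirichlet L ^ r :: real poly) s)\<^sup>2)"
  define z where "z = cis (\<psi> - 2 * pi * real j / real T)"
  have T: "T > 0" using L r by (simp add: T_def)
  have S: "S > 0" unfolding S_def T_def by (rule sum_coeff_sq_pos[OF L r])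
  have "(\<Sum>t<T. fourier_mat T j t * of_real (taper r L t) * cis (real t * \<psi>)) =
     (\<Sum>t<T. coeff (dirichlet L ^ r) t * z ^ t) / (of_real (sqrt (real T)) * of_real (sqrt S))"
    unfolding sum_divide_distrib
  proof (intro sum.cong refl)
    fix t
    have "cis (- 2 * pi * real j * real t / real T) * cis (real t * \<psi>) = z ^ t"
      unfolding z_def Complex.DeMoivre cis_mult by (rule arg_cong[where f = cis]) (simp add: algebra_simps)
    moreover have "taper r L t = coeff (dirichlet L ^ r) t / sqrt S"
      by (simp add: taper_def S_def T_def)
    ultimately show "fourier_mat T j t * of_real (taper r L t) * cis (real t * \<psi>) =
      coeff (dirichlet L ^ r) t * z ^ t / (of_real (sqrt (real T)) * of_real (sqrt S))"
      by (simp add: fourier_mat_def coeff_dirichlet_power_of_real mult_ac)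
  qed
  also have "(\<Sum>t<T. coeff (dirichlet L ^ r) t * z ^ t) = (\<Sum>i<L. z ^ i) ^ r"
    unfolding T_def by (rule sum_coeff_dirichlet_power[OF L r])
  finally have k: "kern T (taper r L) j \<psi> = cmod (\<Sum>i<L. z ^ i) ^ (2 * r) / (real T * S)"
    using T S unfolding kern_def
    by (simp add: norm_divide norm_mult norm_power power_divide power_mult_distrib power_mult[symmetric] mult.commute)
  have z1: "2 * \<sigma> \<le> cmod (z - 1)"
  proof -
    have "sin ((\<psi> - 2 * pi * real j / real T) / 2) = - sin (pi * real j / real T - \<psi> / 2)"
      unfolding sin_minus[symmetric] by (rule arg_cong[where f = sin]) (simp add: field_simps)
    then show ?thesis using \<sigma> unfolding z_def cmod_cis_minus_1 T_def by simp
  qed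
  then have "z \<noteq> 1" using \<sigma> by auto
  have "cmod (\<Sum>i<L. z ^ i) \<le> 1 / \<sigma>"
  proof -
    have "cmod (\<Sum>i<L. z ^ i) = cmod (z ^ L - 1) / cmod (z - 1)"
      using \<open>z \<noteq> 1\<close> by (simp add: geometric_sum norm_divide)
    also have "\<dots> \<le> 2 / (2 * \<sigma>)"
    proof (rule frac_le)
      have "cmod (z ^ L) = 1" by (simp add: z_def norm_power)
      then show "cmod (z ^ L - 1) \<le> 2" using norm_triangle_ineq4[of "z ^ L" 1] by simp
    qed (use z1 \<sigma> in auto)
    finally show ?thesis by simp
  qed
  then have "cmod (\<Sum>i<L. z ^ i) ^ (2 * r) \<le> (1 / \<sigma>) ^ (2 * r)" by (rule power_mono) simp
  then have "kern T (taper r L) j \<psi> \<le> (1 / \<sigma>) ^ (2 * r) / real L ^ (2 * r)"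
    unfolding k using sum_coeff_sq_ge[OF L r] L by (intro frac_le) (auto simp: T_def S_def \<sigma>(1) less_imp_le)
  then show ?thesis using T_def by (simp add: power_divide power_mult_distrib mult.commute)
qed

lemma kern_nonneg: "0 \<le> kern T a j \<psi>"
  by (simp add: kern_def)

text \<open>Parseval: the Fourier matrix preserves the norm of the clock state, and the phases have
  modulus 1.\<close>

lemma sum_kern:
  assumes "(\<Sum>t<T. (a t)\<^sup>2) = 1" shows "(\<Sum>j<T. kern T a j \<psi>) = 1"
proof -
  let ?v = "\<lambda>t. of_real (a t) * cis (real t * \<psi>)"
  let ?w = "mat_apply T (fourier_mat T) ?v"
  have "complex_of_real (\<Sum>j<T. kern T a j \<psi>) = ip T ?w ?w"
    unfolding ip_self by (rule arg_cong[where f = of_real]) (simp add: mat_apply_def kern_def mult.assoc)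
  also have "\<dots> = ip T ?v ?v" by (rule ip_mat_apply[OF unitary_on_fourier_mat])
  also have "\<dots> = of_real (\<Sum>t<T. (a t)\<^sup>2)"
    unfolding ip_self by (simp add: norm_mult)
  finally show ?thesis using assms by (simp only: of_real_eq_iff)
qed

text \<open>Reading \<open>j\<close> stands for the phase \<open>2 * pi * j / (r * L)\<close>, so
  the window collects the phases of modulus at most \<open>4 * pi / L\<close> modulo
  \<open>2 * pi\<close>, a cut between \<open>2 * pi / L\<close> and
  \<open>8 * pi / L\<close>.\<close>

definition window :: "nat \<Rightarrow> nat \<Rightarrow> nat set" where
  "window r L = {j. j < r * L \<and> (j \<le> 2 * r \<or> r * L - 2 * r \<le> j)}"

lemma sum_inverse_squares_tail:
  assumes "n > 0" "n \<le> m" shows "(\<Sum>j\<in>{n<..m}. 1 / (real j)\<^sup>2) \<le> 1 / real n - 1 / real m"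
  using assms(2)
proof (induction m rule: dec_induct)
  case (step m)
  have m: "m > 0" using assms step by simp
  have "{n<..Suc m} = insert (Suc m) {n<..m}" using step by auto
  then have "(\<Sum>j\<in>{n<..Suc m}. 1 / (real j)\<^sup>2) \<le> 1 / (real (Suc m))\<^sup>2 + (1 / real n - 1 / real m)"
    using step by simp
  also have "1 / (real (Suc m))\<^sup>2 \<le> 1 / real m - 1 / real (Suc m)"
  proof -
    have "1 / (real (Suc m))\<^sup>2 \<le> 1 / (real m * real (Suc m))"
      using m by (intro divide_left_mono) (auto simp: power2_eq_square)
    also have "\<dots> = 1 / real m - 1 / real (Suc m)" using m by (simp add: field_simps)
    finally show ?thesis .
  qed
  finally show ?case by simp
qed simp

text \<open>The crude bound \<open>r \<le> 2 ^ r\<close> absorbs the linear factor at the price of a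
  weaker base.\<close>

lemma four_pow_bound: "real r * (1 / 4) ^ (r - 1) \<le> 4 / 2 ^ r"
proof (cases r)
  case (Suc n)
  have "real r \<le> 2 ^ r" using of_nat_less_two_power[of r, where 'a = real] by simp
  then have "real r * (1 / 4) ^ (r - 1) \<le> 2 ^ r * (1 / 4) ^ n" using Suc by (intro mult_mono) auto
  also have "\<dots> = 4 / 2 ^ r" unfolding Suc by (simp add: power_divide power_mult_distrib[symmetric] field_simps)
  finally show ?thesis .
qed simp

text \<open>A reading outside the window has cyclic distance \<open>d > 2 * r\<close> from 0, while
  the phase displaces it by at most \<open>r\<close>. The sine in \<open>kern_taper_le\<close> is
  then at least \<open>d / T\<close>, the kernel at most \<open>(r / d) ^ (2 * r)\<close>, and
  summing over the readings leaves an exponentially small tail.\<close>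

lemma window_ge:
  assumes L: "L > 0" and r: "r > 0" and psi: "\<bar>\<psi>\<bar> \<le> 2 * pi / real L"
  shows "1 - 4 / 2 ^ r \<le> (\<Sum>j\<in>window r L. kern (r * L) (taper r L) j \<psi>)"
proof -
  define T where "T = r * L"
  have T: "T > 0" using L r by (simp add: T_def)
  define B where "B = {2 * r<..<T - 2 * r}"
  have k: "kern T (taper r L) j \<psi> \<le> (1 / 4) ^ (r - 1) * (real r)\<^sup>2 * (1 / (real j)\<^sup>2 + 1 / (real (T - j))\<^sup>2)"
    if j: "j \<in> B" for j
  proof -
    define d where "d = min j (T - j)"
    have d: "2 * r < d" "d \<le> j" "d + j \<le> T" using j by (auto simp: d_def B_def)
    have dr: "d > 0" "j < T" using d by auto
    define y where "y = pi * real j / real T - \<psi> / 2"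
    have psi': "\<bar>\<psi> / 2\<bar> \<le> pi * real r / real T"
      using psi L r by (simp add: T_def field_simps)
    have rd: "2 * real r \<le> real d" "real d \<le> real j" "real d + real j \<le> real T" using d by linarith+
    have y1: "pi * (real j - real r) / real T \<le> y" "y \<le> pi * (real j + real r) / real T"
      using psi' unfolding y_def abs_le_iff right_diff_distrib distrib_left diff_divide_distrib add_divide_distrib
      by linarith+
    have "pi * (real d / 2) / real T \<le> pi * (real j - real r) / real T"
      using rd T by (intro divide_right_mono mult_left_mono) auto
    with y1 have ya: "pi * (real d / 2) / real T \<le> y" by simp
    have "pi * (real j + real r) / real T \<le> pi * (real T - real d / 2) / real T"
      using rd T by (intro divide_right_mono mult_left_mono) auto
    also have "\<dots> = pi - pi * (real d / 2) / real T" using T by (simp add: field_simps)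
    finally have yb: "y \<le> pi - pi * (real d / 2) / real T" using y1 by simp
    have "real d / real T \<le> sin y"
    proof (rule sin_ge_min)
      have "0 \<le> pi * (real d / 2) / real T" by simp
      then show "0 \<le> y" "y \<le> pi" using ya yb by linarith+
      show "real d / real T \<le> 2 * y / pi" using ya by (simp add: field_simps)
      have "pi * (real d / 2) / real T \<le> pi - y" using yb by linarith
      then show "real d / real T \<le> 2 * (pi - y) / pi" by (simp add: field_simps)
    qed
    then have "real d / real T \<le> \<bar>sin (pi * real j / real (r * L) - \<psi> / 2)\<bar>" by (simp add: y_def T_def)
    moreover have "0 < real d / real T" using dr T by simp
    ultimately have "kern T (taper r L) j \<psi> \<le> (1 / (real L * (real d / real T))) ^ (2 * r)"
      unfolding T_def by (intro kern_taper_le L r)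
    also have "1 / (real L * (real d / real T)) = real r / real d" using L by (simp add: T_def)
    \<comment> \<open>One factor \<open>(r / d)^2\<close> is kept to make the sum over
      \<open>j\<close> converge; each of the other \<open>r - 1\<close> is at most
      \<open>1 / 4\<close>.\<close>
    also have "(real r / real d) ^ (2 * r) = ((real r / real d)\<^sup>2) ^ (r - 1) * (real r / real d)\<^sup>2"
      using r by (cases r) (simp_all add: power_mult[symmetric] power_add[symmetric] del: power_divide)
    also have "\<dots> \<le> (1 / 4) ^ (r - 1) * ((real r)\<^sup>2 * (1 / (real j)\<^sup>2 + 1 / (real (T - j))\<^sup>2))"
    proof (intro mult_mono power_mono)
      have "real r / real d \<le> 1 / 2" using rd dr by (simp add: field_simps)
      then have "(real r / real d)\<^sup>2 \<le> (1 / 2)\<^sup>2" by (rule power_mono) simp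
      then show "(real r / real d)\<^sup>2 \<le> 1 / 4" by (simp add: power_divide)
      have "1 / (real d)\<^sup>2 \<le> 1 / (real j)\<^sup>2 + 1 / (real (T - j))\<^sup>2"
        unfolding d_def min_def by auto
      then show "(real r / real d)\<^sup>2 \<le> (real r)\<^sup>2 * (1 / (real j)\<^sup>2 + 1 / (real (T - j))\<^sup>2)"
        using mult_left_mono[of "1 / (real d)\<^sup>2" "1 / (real j)\<^sup>2 + 1 / (real (T - j))\<^sup>2" "(real r)\<^sup>2"]
        by (simp add: power_divide)
    qed auto
    finally show ?thesis by (simp add: mult.assoc)
  qed
  \<comment> \<open>The reflection \<open>T - j\<close> maps \<open>B\<close> to itself, so both
    ends of the clock contribute the same amount.\<close>
  have refl: "(\<Sum>j\<in>B. 1 / (real (T - j))\<^sup>2) = (\<Sum>j\<in>B. 1 / (real j)\<^sup>2)"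
    by (rule sum.reindex_bij_witness[where i = "\<lambda>j. T - j" and j = "\<lambda>j. T - j"]) (auto simp: B_def)
  have sq: "(\<Sum>j\<in>B. 1 / (real j)\<^sup>2) \<le> 1 / (2 * real r)"
  proof (cases "2 * r \<le> T")
    case True
    have "(\<Sum>j\<in>B. 1 / (real j)\<^sup>2) \<le> (\<Sum>j\<in>{2 * r<..T}. 1 / (real j)\<^sup>2)"
      by (rule sum_mono2) (auto simp: B_def)
    also have "\<dots> \<le> 1 / real (2 * r) - 1 / real T" using r True by (intro sum_inverse_squares_tail) auto
    also have "\<dots> \<le> 1 / (2 * real r)" by simp
    finally show ?thesis .
  qed (simp add: B_def)
  have "(\<Sum>j\<in>B. kern T (taper r L) j \<psi>) \<le>
     (\<Sum>j\<in>B. (1 / 4) ^ (r - 1) * (real r)\<^sup>2 * (1 / (real j)\<^sup>2 + 1 / (real (T - j))\<^sup>2))"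
    by (rule sum_mono) (rule k)
  also have "\<dots> = (1 / 4) ^ (r - 1) * (real r)\<^sup>2 * (2 * (\<Sum>j\<in>B. 1 / (real j)\<^sup>2))"
    by (simp only: sum_distrib_left[symmetric] sum.distrib refl mult_2)
  also have "\<dots> \<le> (1 / 4) ^ (r - 1) * (real r)\<^sup>2 * (2 * (1 / (2 * real r)))"
    using sq by (intro mult_left_mono) auto
  also have "\<dots> = real r * (1 / 4) ^ (r - 1)" using r by (simp add: power2_eq_square)
  also have "\<dots> \<le> 4 / 2 ^ r" by (rule four_pow_bound)
  finally have tail: "(\<Sum>j\<in>B. kern T (taper r L) j \<psi>) \<le> 4 / 2 ^ r" .
  have "{..<T} = window r L \<union> B" "window r L \<inter> B = {}"
    by (auto simp: window_def B_def T_def[symmetric])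
  then have "1 = (\<Sum>j\<in>window r L. kern T (taper r L) j \<psi>) + (\<Sum>j\<in>B. kern T (taper r L) j \<psi>)"
    using sum_kern[OF sum_taper_sq[OF L r], of \<psi>] unfolding T_def[symmetric]
    by (metis sum.union_disjoint finite_Un finite_lessThan)
  then show ?thesis using tail by (simp add: T_def)
qed

text \<open>Here the sine is at least \<open>4 / L\<close> on the whole window, so each kernel value
  is at most \<open>(1 / 4) ^ (2 * r)\<close>; the window has no more than \<open>5 * r\<close>
  readings.\<close>

lemma window_le:
  assumes L: "L > 0" and r: "r > 0" and psi: "8 * pi / real L \<le> \<bar>\<psi>\<bar>" "\<bar>\<psi>\<bar> \<le> pi"
  shows "(\<Sum>j\<in>window r L. kern (r * L) (taper r L) j \<psi>) \<le> 4 / 2 ^ r"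
proof -
  define T where "T = r * L"
  have T: "T > 0" using L r by (simp add: T_def)
  have "8 * pi / real L \<le> pi" using psi by linarith
  then have L8: "8 \<le> real L" using L by (simp add: field_simps)
  have k: "kern T (taper r L) j \<psi> \<le> (1 / 4) ^ (2 * r)" if j: "j \<in> window r L" for j
  proof -
    \<comment> \<open>\<open>|\<psi>| / 2\<close> lies between \<open>4 * pi / L\<close> and
      \<open>pi / 2\<close>. A shift by at most \<open>2 * pi / L\<close>, itself at most
      \<open>pi / 4\<close>, keeps the distance \<open>2 * pi / L\<close> from both zeros of the
      sine.\<close>
    have main: "4 / real L \<le> sin (\<bar>\<psi>\<bar> / 2 + \<delta>)" if "\<bar>\<delta>\<bar> \<le> 2 * pi / real L" for \<delta>
    proof (rule sin_ge_min)
      have *: "2 * pi / real L \<le> pi / 4" using L8 by (simp add: field_simps)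
      have **: "8 * pi / real L = 4 * (2 * pi / real L)" by simp
      have a: "2 * pi / real L \<le> \<bar>\<psi>\<bar> / 2 + \<delta>" using that psi ** by linarith
      have b: "2 * pi / real L \<le> pi - (\<bar>\<psi>\<bar> / 2 + \<delta>)" using that psi * by linarith
      have c: "0 \<le> 2 * pi / real L" by simp
      show "0 \<le> \<bar>\<psi>\<bar> / 2 + \<delta>" "\<bar>\<psi>\<bar> / 2 + \<delta> \<le> pi" using a b c by linarith+
      show "4 / real L \<le> 2 * (\<bar>\<psi>\<bar> / 2 + \<delta>) / pi" using a L by (simp add: field_simps)
      show "4 / real L \<le> 2 * (pi - (\<bar>\<psi>\<bar> / 2 + \<delta>)) / pi" using b L by (simp add: field_simps)
    qed
    have small: "\<bar>pi * real i / real T\<bar> \<le> 2 * pi / real L" if "i \<le> 2 * r" for i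
    proof -
      have "real i \<le> 2 * real r" using that by linarith
      then have "pi * real i / real T \<le> pi * (2 * real r) / real T" by (intro divide_right_mono mult_left_mono) auto
      also have "\<dots> = 2 * pi / real L" using r L by (simp add: T_def)
      finally show ?thesis by simp
    qed
    define y where "y = pi * real j / real T"
    \<comment> \<open>A reading at the upper end of the clock counts as a small negative one:
      subtracting \<open>pi\<close> from \<open>y\<close> only changes the sign of the sine.\<close>
    have "\<exists>\<delta>. \<bar>\<delta>\<bar> \<le> 2 * pi / real L \<and> \<bar>sin (y - \<psi> / 2)\<bar> = \<bar>sin (\<psi> / 2 - \<delta>)\<bar>"
    proof (cases "j \<le> 2 * r")
      case True
      have "\<bar>sin (y - \<psi> / 2)\<bar> = \<bar>sin (\<psi> / 2 - y)\<bar>"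
        using sin_minus[of "y - \<psi> / 2"] by simp
      then show ?thesis using small[OF True] y_def by blast
    next
      case False
      then have "T - j \<le> 2 * r" "j < T" using j by (auto simp: window_def T_def)
      then have s: "\<bar>pi * real (T - j) / real T\<bar> \<le> 2 * pi / real L" by (intro small)
      have "pi * real (T - j) / real T = pi - y"
        using \<open>j < T\<close> by (simp add: y_def of_nat_diff field_simps)
      with s have "\<bar>y - pi\<bar> \<le> 2 * pi / real L" by (simp add: abs_minus_commute)
      moreover have "\<bar>sin (y - \<psi> / 2)\<bar> = \<bar>sin (\<psi> / 2 - (y - pi))\<bar>"
      proof -
        have "\<psi> / 2 - (y - pi) = (\<psi> / 2 - y) + pi" by simp
        then have "sin (\<psi> / 2 - (y - pi)) = - sin (\<psi> / 2 - y)" by (metis sin_periodic_pi)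
        also have "\<dots> = sin (y - \<psi> / 2)" using sin_minus[of "y - \<psi> / 2"] by simp
        finally show ?thesis by simp
      qed
      ultimately show ?thesis by blast
    qed
    then obtain \<delta> where \<delta>: "\<bar>\<delta>\<bar> \<le> 2 * pi / real L" "\<bar>sin (y - \<psi> / 2)\<bar> = \<bar>sin (\<psi> / 2 - \<delta>)\<bar>" by blast
    have "4 / real L \<le> \<bar>sin (\<psi> / 2 - \<delta>)\<bar>"
    proof (cases "\<psi> \<ge> 0")
      case True
      then show ?thesis using main[of "- \<delta>"] \<delta>(1) by simp
    next
      case False
      then have "sin (\<bar>\<psi>\<bar> / 2 + \<delta>) = - sin (\<psi> / 2 - \<delta>)"
        unfolding sin_minus[symmetric] by simp
      then show ?thesis using main[of \<delta>] \<delta>(1) by simp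
    qed
    then have "4 / real L \<le> \<bar>sin (pi * real j / real (r * L) - \<psi> / 2)\<bar>"
      using \<delta>(2) by (simp add: y_def T_def)
    then have "kern T (taper r L) j \<psi> \<le> (1 / (real L * (4 / real L))) ^ (2 * r)"
      unfolding T_def using L by (intro kern_taper_le L r) auto
    then show ?thesis using L by simp
  qed
  have card: "card (window r L) \<le> 5 * r"
  proof -
    have "window r L \<subseteq> {..2 * r} \<union> {T - 2 * r..<T}" by (auto simp: window_def T_def)
    then have "card (window r L) \<le> card ({..2 * r} \<union> {T - 2 * r..<T})" by (intro card_mono) auto
    also have "\<dots> \<le> card {..2 * r} + card {T - 2 * r..<T}" by (rule card_Un_le)
    also have "\<dots> \<le> 5 * r" using r by simp
    finally show ?thesis .
  qed
  have "(\<Sum>j\<in>window r L. kern T (taper r L) j \<psi>) \<le> (\<Sum>j\<in>window r L. (1 / 4) ^ (2 * r))"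
    by (rule sum_mono) (rule k)
  also have "\<dots> = real (card (window r L)) * (1 / 4) ^ (2 * r)" by simp
  also have "\<dots> \<le> real (5 * r) * (1 / 4) ^ (2 * r)" using card by (intro mult_right_mono) auto
  also have "\<dots> = (5 / 4 * (1 / 4) ^ r) * (real r * (1 / 4) ^ (r - 1))"
    using r by (cases r) (simp_all add: power_add mult_2 mult_2_right field_simps)
  also have "\<dots> \<le> 1 * (4 / 2 ^ r)"
  proof (rule mult_mono[OF _ four_pow_bound])
    have "(1 / 4 :: real) ^ r \<le> (1 / 4) ^ 1" using r by (intro power_decreasing) auto
    then show "5 / 4 * (1 / 4 :: real) ^ r \<le> 1" by simp
  qed auto
  finally show ?thesis by (simp add: T_def)
qed

section \<open>Detecting an input of small bias\<close>

text \<open>The probability of a reading in the window when the phase is \<open>\<psi>\<close> or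
  \<open>- \<psi>\<close> with equal chance.\<close>

definition gwin :: "nat \<Rightarrow> nat \<Rightarrow> real \<Rightarrow> real" where
  "gwin r L \<psi> = (\<Sum>j\<in>window r L. (kern (r * L) (taper r L) j \<psi> + kern (r * L) (taper r L) j (- \<psi>)) / 2)"

lemma gwin_eq:
  "gwin r L \<psi> = ((\<Sum>j\<in>window r L. kern (r * L) (taper r L) j \<psi>) +
     (\<Sum>j\<in>window r L. kern (r * L) (taper r L) j (- \<psi>))) / 2"
  by (simp add: gwin_def sum.distrib flip: sum_divide_distrib)

lemma gwin_nonneg: "0 \<le> gwin r L \<psi>"
  unfolding gwin_def by (intro sum_nonneg) (simp add: kern_nonneg)

lemma gwin_ge:
  assumes "L > 0" "r > 0" "0 \<le> \<psi>" "\<psi> \<le> 2 * pi / real L"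
  shows "1 - 4 / 2 ^ r \<le> gwin r L \<psi>"
  using window_ge[of L r \<psi>] window_ge[of L r "- \<psi>"] assms by (simp add: gwin_eq)

lemma gwin_le:
  assumes "L > 0" "r > 0" "8 * pi / real L \<le> \<psi>" "\<psi> \<le> pi" "0 \<le> \<psi>"
  shows "gwin r L \<psi> \<le> 4 / 2 ^ r"
  using window_le[of L r \<psi>] window_le[of L r "- \<psi>"] assms by (simp add: gwin_eq)

definition angle :: "real \<Rightarrow> real" where
  "angle s = arccos (1 - 2 * s)"

text \<open>Half the angle has sine \<open>sqrt s\<close>; the two estimates are
  \<open>sin x \<le> x\<close> and Jordan's inequality at that point.\<close>

lemma angle:
  assumes "0 \<le> s" "s \<le> 1"
  shows "cos (angle s) = 1 - 2 * s" "0 \<le> angle s" "angle s \<le> pi"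
    "2 * sqrt s \<le> angle s" "angle s \<le> pi * sqrt s"
proof -
  show c: "cos (angle s) = 1 - 2 * s" using assms by (simp add: angle_def)
  show a: "0 \<le> angle s" "angle s \<le> pi" using assms by (simp_all add: angle_def arccos_lbound arccos_ubound)
  have "(sin (angle s / 2))\<^sup>2 = s" using c cos_double_sin[of "angle s / 2"] by simp
  moreover have "0 \<le> sin (angle s / 2)" using a by (intro sin_ge_zero) auto
  ultimately have s: "sin (angle s / 2) = sqrt s" by (metis real_sqrt_unique)
  show "2 * sqrt s \<le> angle s" using sin_x_le_x[of "angle s / 2"] a s by simp
  show "angle s \<le> pi * sqrt s" using sin_ge_linear[of "angle s / 2"] a s by (simp add: field_simps)
qed

lemma sum_window_slices:
  fixes g :: "nat \<Rightarrow> real"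
  assumes "J \<subseteq> {..<T}"
  shows "(\<Sum>n\<in>{..<D * T} \<inter> {n. n mod T \<in> J}. g n) = (\<Sum>j\<in>J. \<Sum>i<D. g (i * T + j))"
proof -
  have "(\<Sum>n\<in>{..<D * T} \<inter> {n. n mod T \<in> J}. g n) = (\<Sum>n<D * T. if n mod T \<in> J then g n else 0)"
    by (simp add: sum.inter_restrict)
  also have "\<dots> = (\<Sum>i<D. \<Sum>t<T. if t \<in> J then g (i * T + t) else 0)"
    unfolding sum_upt_split by (intro sum.cong refl) simp
  also have "\<dots> = (\<Sum>i<D. \<Sum>t\<in>J. g (i * T + t))"
  proof (rule sum.cong[OF refl])
    fix i
    have "{..<T} \<inter> J = J" using assms by auto
    then show "(\<Sum>t<T. if t \<in> J then g (i * T + t) else 0) = (\<Sum>t\<in>J. g (i * T + t))"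
      using sum.inter_restrict[of "{..<T}" "\<lambda>t. g (i * T + t)" J] by simp
  qed
  also have "\<dots> = (\<Sum>j\<in>J. \<Sum>i<D. g (i * T + j))" by (rule sum.swap)
  finally show ?thesis .
qed

lemma window_subset: "window r L \<subseteq> {..<r * L}"
  by (auto simp: window_def)

context unitary_oracle
begin

lemma amp_est_window:
  assumes gs: "valid_circ (K * A) gs" and gs0: "valid_circ (K * A) gs0" and P: "P \<subseteq> {..<K * A}"
    and orth: "\<And>p q. p \<in> P \<Longrightarrow> q \<in> P \<Longrightarrow>
      (\<Sum>n\<in>{..<K * A} \<inter> F. cnj (run A gs (basis q) n) * run A gs (basis p) n) = (if q = p then of_real (s p) else 0)"
    and s: "\<And>p. p \<in> P \<Longrightarrow> 0 \<le> s p \<and> s p \<le> 1"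
    and init: "run A gs0 (basis 0) = (\<lambda>i. \<Sum>p\<in>P. c p * basis p i)"
    and KA: "K * A > 0" and L: "L > 0" and r: "r > 0"
  shows "(\<Sum>n\<in>{..<K * (A * (r * L))} \<inter> {n. n mod (r * L) \<in> window r L}.
      (cmod (run_circuit K (A * (r * L)) Or (amp_est (r * L) (taper r L) gs0 gs F P) n))\<^sup>2) =
    (\<Sum>p\<in>P. (cmod (c p))\<^sup>2 * gwin r L (angle (s p)))"
proof -
  let ?T = "r * L"
  let ?k = "\<lambda>j p. (kern ?T (taper r L) j (angle (s p)) + kern ?T (taper r L) j (- angle (s p))) / 2"
  have e: "K * (A * ?T) = K * A * ?T" by simp
  have "(\<Sum>n\<in>{..<K * (A * ?T)} \<inter> {n. n mod ?T \<in> window r L}.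
      (cmod (run_circuit K (A * ?T) Or (amp_est ?T (taper r L) gs0 gs F P) n))\<^sup>2) =
    (\<Sum>j\<in>window r L. \<Sum>p\<in>P. (cmod (c p))\<^sup>2 * ?k j p)"
    unfolding e sum_window_slices[OF window_subset]
  proof (rule sum.cong[OF refl])
    fix j assume "j \<in> window r L"
    then have j: "j < ?T" using window_subset by blast
    show "(\<Sum>i<K * A. (cmod (run_circuit K (A * ?T) Or (amp_est ?T (taper r L) gs0 gs F P) (i * ?T + j)))\<^sup>2) =
      (\<Sum>p\<in>P. (cmod (c p))\<^sup>2 * ?k j p)"
      by (rule amp_est_outcome[OF gs gs0 P orth _ init KA sum_taper_sq[OF L r] j]) (use s angle(1) in auto)
  qed
  also have "\<dots> = (\<Sum>p\<in>P. (cmod (c p))\<^sup>2 * gwin r L (angle (s p)))"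
    by (subst sum.swap) (simp only: gwin_def sum_distrib_left)
  finally show ?thesis .
qed

lemma sum_run_circuit:
  assumes "valid_circ (K * A) gs" "K * A > 0"
  shows "(\<Sum>n<K * A. (cmod (run_circuit K A Or gs n))\<^sup>2) = 1"
proof -
  have "complex_of_real (\<Sum>n<K * A. (cmod (run_circuit K A Or gs n))\<^sup>2) = ip (K * A) (basis 0) (basis 0)"
    unfolding run_circuit_eq ip_self[symmetric] by (rule ip_run[OF assms(1)])
  also have "\<dots> = 1" using assms(2) by (simp add: ip_basis_left) (simp add: basis_def)
  finally show ?thesis by (simp only: of_real_eq_1_iff)
qed

end

section \<open>The concrete circuits\<close>

definition starts :: "nat \<Rightarrow> nat \<Rightarrow> nat set" where
  "starts N m = (\<lambda>x. x * 2 ^ m) ` {..<N}"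

definition unif :: "nat \<Rightarrow> nat \<Rightarrow> nat \<Rightarrow> real" where
  "unif N m j = (if j \<in> starts N m then 1 / sqrt (real N) else 0)"

text \<open>The answer bit is the low-order digit of the index, so odd indices carry answer
  1.\<close>

definition parity_circ :: "gate list" where
  "parity_circ = [Query, Gate (flip_mat {n. odd n}), QueryInv]"

text \<open>The flagged set is again \<open>starts N m\<close>: what is estimated for input
  \<open>x\<close> is the probability that the parity circuit returns to its start state,
  \<open>(2 * eps_x)^2\<close>.\<close>

definition inner_circ :: "nat \<Rightarrow> nat \<Rightarrow> nat \<Rightarrow> nat \<Rightarrow> gate list" where
  "inner_circ N m r L = amp_est (r * L) (taper r L) [Gate (prep_mat (unif N m))] parity_circ
     (starts N m) (starts N m)"

definition outer_circ :: "nat \<Rightarrow> nat \<Rightarrow> nat \<Rightarrow> nat \<Rightarrow> nat \<Rightarrow> nat \<Rightarrow> gate list" where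
  "outer_circ N m r L R M = amp_est (R * M) (taper R M) [] (inner_circ N m r L)
     {n. n mod (r * L) \<in> window r L} {0}"

lemma starts_subset: "starts N m \<subseteq> {..<oracle_dim N m}"
  by (auto simp: starts_def oracle_dim_def)

lemma inj_starts: "inj_on (\<lambda>x. x * 2 ^ m) (S :: nat set)"
  by (auto simp: inj_on_def)

lemma sum_unif_sq:
  assumes "N \<ge> 1" shows "(\<Sum>i<oracle_dim N m. (unif N m i)\<^sup>2) = 1"
proof -
  have "(\<Sum>i<oracle_dim N m. (unif N m i)\<^sup>2) = (\<Sum>i<oracle_dim N m. if i \<in> starts N m then 1 / real N else 0)"
    by (intro sum.cong refl) (auto simp: unif_def power_divide)
  also have "\<dots> = (\<Sum>i\<in>starts N m. 1 / real N)"
    using starts_subset[of N m] by (simp add: sum.inter_restrict[symmetric] Int_absorb1)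
  also have "\<dots> = 1" using assms by (simp add: starts_def card_image inj_starts)
  finally show ?thesis .
qed

lemma oracle_dim_pos: "N \<ge> 1 \<Longrightarrow> 0 < oracle_dim N m"
  by (simp add: oracle_dim_def)

lemma valid_circ_inner:
  assumes "N \<ge> 1" "r > 0" "L > 0"
  shows "valid_circ (oracle_dim N m * (r * L)) (inner_circ N m r L)"
  unfolding inner_circ_def
  by (rule valid_circ_amp_est)
    (use assms in \<open>simp_all add: parity_circ_def unitary_on_flip_mat sum_taper_sq
      prep_mat_unit(1)[OF oracle_dim_pos sum_unif_sq]\<close>)

lemma valid_circ_outer:
  assumes "N \<ge> 1" "r > 0" "L > 0" "R > 0" "M > 0"
  shows "valid_circ (oracle_dim N m * (r * L * (R * M))) (outer_circ N m r L R M)"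
  unfolding outer_circ_def mult.assoc[of "oracle_dim N m", symmetric]
  by (rule valid_circ_amp_est[OF _ _ _ sum_taper_sq])
    (use assms valid_circ_inner[of N r L m] in \<open>simp_all add: mult.assoc\<close>)

text \<open>Three factors of 2: circuit and adjoint at the outer level, the same at the inner level,
  and the two queries of \<open>parity_circ\<close>.\<close>

lemma count_queries_outer: "count_queries (outer_circ N m r L R M) = 8 * (r * L) * (R * M)"
  by (simp add: outer_circ_def inner_circ_def count_queries_amp_est parity_circ_def)

section \<open>Stopping probabilities for a biased oracle\<close>

locale biased =
  fixes N m :: nat and f :: "nat \<Rightarrow> bool" and \<epsilon> :: real and Or :: cmat
  assumes N: "N \<ge> 1" and m: "m \<ge> 1" and eps: "0 < \<epsilon>" and biased: "biased_oracle N m f \<epsilon> Or"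
begin

sublocale unitary_oracle "oracle_dim N m" Or
  using biased by unfold_locales (simp add: biased_oracle_def)

abbreviation "K \<equiv> oracle_dim N m"

lemma block:
  assumes "x < N" "j < K" "j div 2 ^ m \<noteq> x" shows "Or j (x * 2 ^ m) = 0"
  using biased assms by (simp add: biased_oracle_def)

text \<open>The column of input \<open>x\<close> lives in block \<open>x\<close>. A weight
  \<open>s\<close> on the answer bit treats the norm of the column and its signed version
  together.\<close>

lemma sum_block:
  assumes x: "x < N"
  shows "(\<Sum>i<K. s (odd i) * (cmod (Or i (x * 2 ^ m)))\<^sup>2) =
    (\<Sum>w<2 ^ (m - 1). s False * (cmod (Or (x * 2 ^ m + 2 * w) (x * 2 ^ m)))\<^sup>2 +
       s True * (cmod (Or (x * 2 ^ m + 2 * w + 1) (x * 2 ^ m)))\<^sup>2)"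
proof -
  let ?g = "\<lambda>i. s (odd i) * (cmod (Or i (x * 2 ^ m)))\<^sup>2"
  obtain m' where m': "m = Suc m'" using m by (cases m) auto
  have "(\<Sum>i<K. ?g i) = (\<Sum>y<N. if y = x then \<Sum>b<2 ^ m. ?g (x * 2 ^ m + b) else 0)"
    unfolding oracle_dim_def sum_upt_split
  proof (intro sum.cong refl)
    fix y assume y: "y \<in> {..<N}"
    have "Or (y * 2 ^ m + b) (x * 2 ^ m) = 0" if "y \<noteq> x" "b < 2 ^ m" for b
      by (rule block) (use x y that index_lt[of y N b "2 ^ m"] in \<open>auto simp: oracle_dim_def\<close>)
    then show "(\<Sum>b<2 ^ m. ?g (y * 2 ^ m + b)) = (if y = x then \<Sum>b<2 ^ m. ?g (x * 2 ^ m + b) else 0)"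
      by auto
  qed
  also have "\<dots> = (\<Sum>b<2 ^ m' * 2. ?g (x * 2 ^ m + b))" using x by (simp add: m' mult.commute)
  also have "\<dots> = (\<Sum>w<2 ^ m'. \<Sum>b<2. ?g (x * 2 ^ m + (w * 2 + b)))" by (rule sum_upt_split)
  also have "\<dots> = (\<Sum>w<2 ^ m'. s False * (cmod (Or (x * 2 ^ m + 2 * w) (x * 2 ^ m)))\<^sup>2 +
       s True * (cmod (Or (x * 2 ^ m + 2 * w + 1) (x * 2 ^ m)))\<^sup>2)"
  proof (intro sum.cong refl)
    fix w
    have "{..<2::nat} = {0, 1}" by auto
    then have "(\<Sum>b<2. ?g (x * 2 ^ m + (w * 2 + b))) = ?g (x * 2 ^ m + 2 * w) + ?g (x * 2 ^ m + 2 * w + 1)"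
      by (simp add: mult.commute add.assoc)
    moreover have "even (x * 2 ^ m + 2 * w)" using m by simp
    moreover have "odd (x * 2 ^ m + 2 * w + 1)" using m by simp
    ultimately show "(\<Sum>b<2. ?g (x * 2 ^ m + (w * 2 + b))) =
       s False * (cmod (Or (x * 2 ^ m + 2 * w) (x * 2 ^ m)))\<^sup>2 +
       s True * (cmod (Or (x * 2 ^ m + 2 * w + 1) (x * 2 ^ m)))\<^sup>2" by (simp only: not_True_eq_False not_False_eq_True)
  qed
  finally show ?thesis using m' by simp
qed

lemma start_lt: "x < N \<Longrightarrow> x * 2 ^ m < K"
  using starts_subset[of N m] by (auto simp: starts_def)

text \<open>The column has norm 1, so the weights of the two answers sum to 1 and their difference
  is, up to the sign given by \<open>f x\<close>, twice the larger weight minus 1.\<close>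

lemma signed_norm:
  assumes x: "x < N"
  shows "(\<Sum>i<K. (if odd i then - 1 else 1) * (cmod (Or i (x * 2 ^ m)))\<^sup>2) =
      (if f x then - 1 else 1) * (2 * eps_x m f Or x)"
    and "eps_x m f Or x \<le> 1 / 2"
proof -
  let ?a = "\<Sum>w<2 ^ (m - 1). (cmod (Or (x * 2 ^ m + 2 * w) (x * 2 ^ m)))\<^sup>2"
  let ?b = "\<Sum>w<2 ^ (m - 1). (cmod (Or (x * 2 ^ m + 2 * w + 1) (x * 2 ^ m)))\<^sup>2"
  have "complex_of_real (\<Sum>i<K. (cmod (Or i (x * 2 ^ m)))\<^sup>2) = 1"
    using unitary_on_columns[OF unitary start_lt[OF x] start_lt[OF x]] ip_self[of K "\<lambda>i. Or i (x * 2 ^ m)"]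
    by (simp add: ip_def)
  then have "(\<Sum>i<K. (cmod (Or i (x * 2 ^ m)))\<^sup>2) = 1" by (simp only: of_real_eq_1_iff)
  then have ab: "?a + ?b = 1" using sum_block[OF x, of "\<lambda>b. 1"] by (simp add: sum.distrib)
  have "(\<Sum>i<K. (if odd i then - 1 else 1) * (cmod (Or i (x * 2 ^ m)))\<^sup>2) = ?a - ?b"
    using sum_block[OF x, of "\<lambda>b. if b then - 1 else 1"] by (simp add: sum_subtractf)
  moreover have "alpha_sq m f Or x = (if f x then ?b else ?a)" by (simp add: alpha_sq_def)
  ultimately show "(\<Sum>i<K. (if odd i then - 1 else 1) * (cmod (Or i (x * 2 ^ m)))\<^sup>2) =
      (if f x then - 1 else 1) * (2 * eps_x m f Or x)"
    using ab by (auto simp: eps_x_def)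
  have "?a \<ge> 0" "?b \<ge> 0" by (auto intro: sum_nonneg)
  then show "eps_x m f Or x \<le> 1 / 2"
    using ab \<open>alpha_sq m f Or x = (if f x then ?b else ?a)\<close> by (auto simp: eps_x_def)
qed

lemma eps_x_pos: "x < N \<Longrightarrow> 0 < eps_x m f Or x"
  using biased eps by (force simp: biased_oracle_def eps_x_def)

lemma eps_x_sq_range:
  assumes "x < N" shows "0 \<le> (2 * eps_x m f Or x)\<^sup>2" "(2 * eps_x m f Or x)\<^sup>2 \<le> 1"
proof -
  show "(2 * eps_x m f Or x)\<^sup>2 \<le> 1"
    by (rule power_le_one) (use signed_norm(2)[OF assms] eps_x_pos[OF assms] in auto)
qed (rule zero_le_power2)

text \<open>Moving the inverse oracle to the other side of the inner product leaves a signed product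
  of two oracle columns. Columns of different inputs have disjoint supports; equal inputs give
  \<open>signed_norm\<close>.\<close>

lemma parity_amplitude:
  assumes x: "x < N" and y: "y < N"
  shows "run 1 parity_circ (basis (x * 2 ^ m)) (y * 2 ^ m) =
    (if x = y then of_real ((if f x then - 1 else 1) * (2 * eps_x m f Or x)) else 0)"
proof -
  have l1: "lift (Suc 0) M = M" for M by (simp add: lift_def fun_eq_iff)
  have col: "mat_apply K Or (basis (z * 2 ^ m)) = (\<lambda>i. if i < K then Or i (z * 2 ^ m) else 0)" if "z < N" for z
    using start_lt[OF that]
    by (auto simp: mat_apply_def basis_def fun_eq_iff if_distrib [where f = "\<lambda>x. _ * x"] cong: if_cong)
  let ?v = "mat_apply K (flip_mat {n. odd n}) (mat_apply K Or (basis (x * 2 ^ m)))"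
  have "run 1 parity_circ (basis (x * 2 ^ m)) = mat_apply K (mat_adj Or) ?v"
    by (simp add: parity_circ_def run_Cons gate_mat_def l1)
  then have "run 1 parity_circ (basis (x * 2 ^ m)) (y * 2 ^ m) = ip K (basis (y * 2 ^ m)) (mat_apply K (mat_adj Or) ?v)"
    by (simp add: ip_basis_left start_lt[OF y])
  also have "\<dots> = ip K (mat_apply K Or (basis (y * 2 ^ m))) ?v"
    by (simp add: ip_mat_apply_right)
  also have "\<dots> = (\<Sum>i<K. cnj (Or i (y * 2 ^ m)) * ((if odd i then - 1 else 1) * Or i (x * 2 ^ m)))"
    unfolding ip_def by (intro sum.cong refl) (simp add: col x y flip_mat_def mat_apply_diag_mat)
  also have "\<dots> = (if x = y then of_real ((if f x then - 1 else 1) * (2 * eps_x m f Or x)) else 0)"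
  proof (cases "x = y")
    case True
    have "(\<Sum>i<K. cnj (Or i (y * 2 ^ m)) * ((if odd i then - 1 else 1) * Or i (x * 2 ^ m))) =
       of_real (\<Sum>i<K. (if odd i then - 1 else 1) * (cmod (Or i (x * 2 ^ m)))\<^sup>2)"
      unfolding of_real_sum
      by (intro sum.cong refl) (auto simp: True complex_norm_square mult_ac simp del: of_real_power)
    then show ?thesis using True signed_norm(1)[OF x] by (simp only: if_True refl)
  next
    case False
    have "(\<Sum>i<K. cnj (Or i (y * 2 ^ m)) * ((if odd i then - 1 else 1) * Or i (x * 2 ^ m))) = 0"
    proof (intro sum.neutral ballI)
      fix i assume "i \<in> {..<K}"
      then show "cnj (Or i (y * 2 ^ m)) * ((if odd i then - 1 else 1) * Or i (x * 2 ^ m)) = 0"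
        using block[OF x, of i] block[OF y, of i] False by (cases "i div 2 ^ m = x") auto
    qed
    then show ?thesis using False by simp
  qed
  finally show ?thesis .
qed

text \<open>A small angle on the outer clock means that no input of small bias has been found.\<close>
definition stop_prob :: "nat \<Rightarrow> nat \<Rightarrow> nat \<Rightarrow> nat \<Rightarrow> real" where
  "stop_prob r L R M = (\<Sum>n\<in>{..<K * (r * L * (R * M))} \<inter> {n. n mod (R * M) \<in> window R M}.
     (cmod (run_circuit K (r * L * (R * M)) Or (outer_circ N m r L R M) n))\<^sup>2)"

text \<open>The probability that the inner clock reads a value in the window, for a uniformly
  distributed input.\<close>

definition flag_prob :: "nat \<Rightarrow> nat \<Rightarrow> real" where
  "flag_prob r L = (\<Sum>x<N. gwin r L (angle ((2 * eps_x m f Or x)\<^sup>2)) / real N)"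

text \<open>On the start states the parity circuit is diagonal, so flagged overlaps of different
  inputs vanish and \<open>amp_est_window\<close> applies with an ancilla of dimension 1.\<close>

lemma inner_flag:
  assumes r: "r > 0" and L: "L > 0"
  shows "(\<Sum>n\<in>{..<K * (r * L)} \<inter> {n. n mod (r * L) \<in> window r L}.
      (cmod (run_circuit K (r * L) Or (inner_circ N m r L) n))\<^sup>2) = flag_prob r L"
proof -
  define s where "s p = (2 * eps_x m f Or (p div 2 ^ m))\<^sup>2" for p
  define c where "c p = complex_of_real (unif N m p)" for p
  let ?P = "starts N m"
  have fin: "finite ?P" by (simp add: starts_def)
  have par: "run 1 parity_circ (basis p) q =
      (if p = q then of_real ((if f (p div 2 ^ m) then - 1 else 1) * (2 * eps_x m f Or (p div 2 ^ m))) else 0)"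
    if "p \<in> ?P" "q \<in> ?P" for p q
    using that parity_amplitude by (auto simp: starts_def)
  have v0: "run 1 [Gate (prep_mat (unif N m))] (basis 0) = (\<lambda>i. \<Sum>p\<in>?P. c p * basis p i)"
  proof
    fix i
    have "(\<Sum>p\<in>?P. c p * basis p i) = (if i \<in> ?P then c i else 0)"
      using fin by (simp add: basis_def if_distrib [where f = "\<lambda>x. _ * x"] cong: if_cong)
    moreover have "mat_apply K (prep_mat (unif N m)) (basis 0) i = (if i \<in> ?P then c i else 0)"
    proof (cases "i < K")
      case True
      then have "mat_apply K (prep_mat (unif N m)) (basis 0) i = prep_mat (unif N m) i 0"
        using oracle_dim_pos[OF N, of m]
        by (simp add: mat_apply_def basis_def if_distrib [where f = "\<lambda>x. _ * x"] cong: if_cong)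
      also have "\<dots> = c i" unfolding c_def
        by (rule prep_mat_unit(2)[OF oracle_dim_pos[OF N] sum_unif_sq[OF N] True])
      finally show ?thesis by (simp add: c_def unif_def)
    next
      case False
      then show ?thesis using starts_subset[of N m] by (auto simp: mat_apply_def)
    qed
    ultimately show "run 1 [Gate (prep_mat (unif N m))] (basis 0) i = (\<Sum>p\<in>?P. c p * basis p i)"
      by simp
  qed
  have "(\<Sum>n\<in>{..<K * (1 * (r * L))} \<inter> {n. n mod (r * L) \<in> window r L}.
      (cmod (run_circuit K (1 * (r * L)) Or (inner_circ N m r L) n))\<^sup>2) =
     (\<Sum>p\<in>?P. (cmod (c p))\<^sup>2 * gwin r L (angle (s p)))"
    unfolding inner_circ_def
  proof (rule amp_est_window[OF _ _ _ _ _ v0 _ L r])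
    show "valid_circ (K * 1) parity_circ" by (simp add: parity_circ_def unitary_on_flip_mat)
    show "valid_circ (K * 1) [Gate (prep_mat (unif N m))]"
      by (simp add: prep_mat_unit(1)[OF oracle_dim_pos[OF N] sum_unif_sq[OF N]])
    show P: "?P \<subseteq> {..<K * 1}" using starts_subset[of N m] by simp
    show "K * 1 > 0" using oracle_dim_pos[OF N, of m] by simp
    show "0 \<le> s p \<and> s p \<le> 1" if "p \<in> ?P" for p
    proof -
      obtain x where "x < N" "p = x * 2 ^ m" using \<open>p \<in> ?P\<close> by (auto simp: starts_def)
      then have "p div 2 ^ m < N" by simp
      then show ?thesis unfolding s_def using eps_x_sq_range by blast
    qed
    show "(\<Sum>n\<in>{..<K * 1} \<inter> ?P. cnj (run 1 parity_circ (basis q) n) * run 1 parity_circ (basis p) n) =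
        (if q = p then of_real (s p) else 0)" if pq: "p \<in> ?P" "q \<in> ?P" for p q
    proof -
      have "{..<K * 1} \<inter> ?P = ?P" using P by auto
      then have "(\<Sum>n\<in>{..<K * 1} \<inter> ?P. cnj (run 1 parity_circ (basis q) n) * run 1 parity_circ (basis p) n) =
        (\<Sum>n\<in>?P. if n = p then (if q = p then of_real (s p) else 0) else 0)"
      proof (intro sum.cong)
        fix n assume "n \<in> ?P"
        then show "cnj (run 1 parity_circ (basis q) n) * run 1 parity_circ (basis p) n =
            (if n = p then (if q = p then of_real (s p) else 0) else 0)"
          by (auto simp only: par pq s_def power2_eq_square split: if_splits) (auto simp: algebra_simps)
      qed
      then show ?thesis using fin pq by simp
    qed
  qed
  also have "\<dots> = flag_prob r L"
    unfolding flag_prob_def starts_def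
  proof (subst sum.reindex[OF inj_starts], intro sum.cong refl)
    fix x assume "x \<in> {..<N}"
    then have "x * 2 ^ m \<in> starts N m" unfolding starts_def by (rule imageI)
    then have "unif N m (x * 2 ^ m) = 1 / sqrt (real N)" by (simp only: unif_def if_True)
    then have "(cmod (c (x * 2 ^ m)))\<^sup>2 = 1 / real N" by (simp add: c_def norm_divide power_divide)
    then show "((\<lambda>p. (cmod (c p))\<^sup>2 * gwin r L (angle (s p))) \<circ> (\<lambda>x. x * 2 ^ m)) x =
      gwin r L (angle ((2 * eps_x m f Or x)\<^sup>2)) / real N" by (simp add: s_def)
  qed
  finally show ?thesis by simp
qed

lemma flag_prob_range:
  assumes r: "r > 0" and L: "L > 0" shows "0 \<le> flag_prob r L" "flag_prob r L \<le> 1"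
proof -
  let ?g = "\<lambda>n. (cmod (run_circuit K (r * L) Or (inner_circ N m r L) n))\<^sup>2"
  show "0 \<le> flag_prob r L" unfolding inner_flag[OF r L, symmetric] by (intro sum_nonneg) simp
  have "flag_prob r L \<le> (\<Sum>n<K * (r * L). ?g n)"
    unfolding inner_flag[OF r L, symmetric] by (rule sum_mono2) auto
  also have "\<dots> = 1"
    by (rule sum_run_circuit) (use valid_circ_inner[OF N r L] oracle_dim_pos[OF N] r L in auto)
  finally show "flag_prob r L \<le> 1" .
qed

text \<open>With a single start state, the overlap condition is just the squared norm of the flagged
  part of the inner circuit, which is \<open>inner_flag\<close>.\<close>

lemma stop_prob_eq:
  assumes r: "r > 0" and L: "L > 0" and R: "R > 0" and M: "M > 0"
  shows "stop_prob r L R M = gwin R M (angle (flag_prob r L))"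
proof -
  let ?F = "{n. n mod (r * L) \<in> window r L}"
  let ?v = "run (r * L) (inner_circ N m r L) (basis 0)"
  have "stop_prob r L R M = (\<Sum>p\<in>{0::nat}. (cmod 1)\<^sup>2 * gwin R M (angle (flag_prob r L)))"
    unfolding stop_prob_def outer_circ_def
  proof (rule amp_est_window[where c = "\<lambda>_. 1" and s = "\<lambda>_. flag_prob r L",
        OF valid_circ_inner[OF N r L] _ _ _ _ _ _ M R])
    show pos: "K * (r * L) > 0" using oracle_dim_pos[OF N, of m] r L by simp
    then show "{0} \<subseteq> {..<K * (r * L)}" by simp
    show "run (r * L) [] (basis 0) = (\<lambda>i. \<Sum>p\<in>{0}. 1 * basis p i)" by simp
    show "0 \<le> flag_prob r L \<and> flag_prob r L \<le> 1" using flag_prob_range[OF r L] by simp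
    fix p q :: nat assume "p \<in> {0}" "q \<in> {0}"
    moreover have "(\<Sum>n\<in>{..<K * (r * L)} \<inter> ?F. cnj (?v n) * ?v n) =
        of_real (\<Sum>n\<in>{..<K * (r * L)} \<inter> ?F. (cmod (?v n))\<^sup>2)"
      by (simp add: complex_norm_square mult.commute del: of_real_power)
    ultimately show "(\<Sum>n\<in>{..<K * (r * L)} \<inter> ?F. cnj (run (r * L) (inner_circ N m r L) (basis q) n) *
        run (r * L) (inner_circ N m r L) (basis p) n) = (if q = p then of_real (flag_prob r L) else 0)"
      using inner_flag[OF r L] by (simp add: run_circuit_eq del: of_real_sum)
  qed simp
  then show ?thesis by simp
qed

text \<open>The input \<open>x\<close> alone contributes at least \<open>1 / (4 * N)\<close> to the
  flagged probability. The outer angle is then at least \<open>1 / sqrt N\<close>, which the outer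
  clock separates from 0.\<close>

lemma stop_prob_le:
  assumes r: "r = 2 * q" and q: "q \<ge> 2" "32 * sqrt (real N) \<le> 2 ^ q" and L: "L > 0" and R: "R > 0"
    and x: "x < N" "eps_x m f Or x \<le> 1 / real L"
  shows "stop_prob r L R (2 ^ q) \<le> 4 / 2 ^ R"
proof -
  have r0: "r > 0" using r q by simp
  define \<psi> where "\<psi> = angle ((2 * eps_x m f Or x)\<^sup>2)"
  have e: "0 < eps_x m f Or x" "eps_x m f Or x \<le> 1 / 2" using eps_x_pos signed_norm(2) x by auto
  note e2 = eps_x_sq_range[OF x(1)]
  have sq: "sqrt ((2 * eps_x m f Or x)\<^sup>2) = 2 * eps_x m f Or x" using e by (intro real_sqrt_unique) auto
  have "\<psi> \<le> pi * (2 * eps_x m f Or x)" using angle(5)[OF e2] by (simp only: \<psi>_def sq)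
  also have "\<dots> \<le> pi * (2 * (1 / real L))" using x by (intro mult_left_mono) auto
  finally have "1 - 4 / 2 ^ r \<le> gwin r L \<psi>"
    using angle(2)[OF e2] by (intro gwin_ge L r0) (auto simp: \<psi>_def mult.commute)
  moreover have "(2::real) ^ 4 \<le> 2 ^ r" using r q by (intro power_increasing) auto
  then have "4 / 2 ^ r \<le> (1 / 4 :: real)" by (simp add: field_simps)
  ultimately have g: "1 / 4 \<le> gwin r L \<psi>" by linarith
  have "gwin r L \<psi> / real N \<le> flag_prob r L"
    unfolding flag_prob_def \<psi>_def using x(1)
    by (intro member_le_sum[of x "{..<N}" "\<lambda>x. gwin r L (angle ((2 * eps_x m f Or x)\<^sup>2)) / real N"])
      (auto simp: gwin_nonneg)
  moreover have "1 / 4 / real N \<le> gwin r L \<psi> / real N" using g by (intro divide_right_mono) auto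
  ultimately have fl: "1 / (4 * real N) \<le> flag_prob r L" by simp
  have "1 / (2 * sqrt (real N)) = sqrt (1 / (4 * real N))" by (simp add: real_sqrt_divide real_sqrt_mult)
  also have "\<dots> \<le> sqrt (flag_prob r L)" using fl by simp
  finally have "1 / sqrt (real N) \<le> 2 * sqrt (flag_prob r L)" by (simp add: field_simps)
  \<comment> \<open>The estimate \<open>pi < 4\<close> is the origin of the constant 32 in the
    hypothesis on \<open>q\<close>.\<close>
  moreover have "8 * pi / 2 ^ q \<le> 32 / (32 * sqrt (real N))"
    using pi_less_4 N q(2) by (intro frac_le) auto
  ultimately have "8 * pi / real (2 ^ q) \<le> angle (flag_prob r L)"
    using angle(4)[OF flag_prob_range[OF r0 L]] by simp
  then show ?thesis
    unfolding stop_prob_eq[OF r0 L R, of "2 ^ q", simplified]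
    by (intro gwin_le R angle flag_prob_range r0 L) auto
qed

text \<open>Each inner angle is at least \<open>4 * eps_x\<close> and hence
  \<open>8 * pi / L\<close>, so every input is flagged only by error.\<close>

lemma stop_prob_ge:
  assumes r: "r = 2 * q" and q: "q \<ge> 2" and L: "L > 0" and R: "R > 0"
    and big: "\<And>x. x < N \<Longrightarrow> 2 * pi / real L \<le> eps_x m f Or x"
  shows "1 - 4 / 2 ^ R \<le> stop_prob r L R (2 ^ q)"
proof -
  have r0: "r > 0" using r q by simp
  have "flag_prob r L \<le> (\<Sum>x<N. 4 / 2 ^ r / real N)"
    unfolding flag_prob_def
  proof (intro sum_mono divide_right_mono)
    fix x assume "x \<in> {..<N}"
    then have x: "x < N" by simp
    have e: "0 < eps_x m f Or x" "eps_x m f Or x \<le> 1 / 2" using eps_x_pos signed_norm(2) x by auto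
    note e2 = eps_x_sq_range[OF x]
    have sq: "sqrt ((2 * eps_x m f Or x)\<^sup>2) = 2 * eps_x m f Or x" using e by (intro real_sqrt_unique) auto
    have "8 * pi / real L = 4 * (2 * pi / real L)" by simp
    also have "\<dots> \<le> 2 * (2 * eps_x m f Or x)" using big[OF x] by linarith
    also have "\<dots> \<le> angle ((2 * eps_x m f Or x)\<^sup>2)" using angle(4)[OF e2] by (simp only: sq)
    finally show "gwin r L (angle ((2 * eps_x m f Or x)\<^sup>2)) \<le> 4 / 2 ^ r"
      using angle(2,3)[OF e2] by (intro gwin_le L r0) auto
  qed simp
  \<comment> \<open>This is the purpose of \<open>r = 2 * q\<close>: the square root of the inner
    error is \<open>2 / 2 ^ q\<close>, so the outer angle stays within the threshold
    \<open>2 * pi / 2 ^ q\<close>.\<close>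
  also have "\<dots> = (2 / 2 ^ q)\<^sup>2"
    using N by (simp add: r power_divide power_mult[symmetric] mult.commute)
  finally have "sqrt (flag_prob r L) \<le> 2 / 2 ^ q" by (simp add: real_le_lsqrt)
  then have "pi * sqrt (flag_prob r L) \<le> pi * (2 / 2 ^ q)" by (intro mult_left_mono) auto
  then have "angle (flag_prob r L) \<le> 2 * pi / real (2 ^ q)"
    using angle(5)[OF flag_prob_range[OF r0 L]] by (simp add: mult.commute)
  then show ?thesis
    unfolding stop_prob_eq[OF r0 L R, of "2 ^ q", simplified]
    by (intro gwin_ge R angle flag_prob_range r0 L) auto
qed

end

section \<open>Adaptive rounds\<close>

text \<open>The strategy sees only the history, so the length of the history is the round number.
  The outcome of a round is judged at the next call, hence the index
  \<open>length h - 1\<close>.\<close>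

definition round_alg ::
  "(nat \<Rightarrow> nat) \<Rightarrow> (nat \<Rightarrow> gate list) \<Rightarrow> (nat \<Rightarrow> nat set) \<Rightarrow> (nat \<Rightarrow> real) \<Rightarrow> strategy" where
  "round_alg A gs S out h =
     (if h \<noteq> [] \<and> last h \<in> S (length h - 1) then Output (out (length h - 1))
      else Circuit (A (length h)) (gs (length h)))"

lemma hist_prob_snoc:
  "hist_prob alg K Or (h @ [n]) = hist_prob alg K Or h * outcome_prob K Or (alg h) n"
proof -
  have "(\<Prod>k<length h. outcome_prob K Or (alg (take k (h @ [n]))) ((h @ [n]) ! k)) =
      (\<Prod>k<length h. outcome_prob K Or (alg (take k h)) (h ! k))"
    by (intro prod.cong refl) (simp add: nth_append)
  then show ?thesis by (simp add: hist_prob_def)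
qed

lemma outcome_prob_nonneg: "0 \<le> outcome_prob K Or a n"
  by (simp add: outcome_prob_def split: action.split)

lemma hist_prob_nonneg: "0 \<le> hist_prob alg K Or h"
  unfolding hist_prob_def by (intro prod_nonneg) (simp add: outcome_prob_nonneg)

locale rounds =
  fixes K :: nat and Or :: cmat and A :: "nat \<Rightarrow> nat" and gs :: "nat \<Rightarrow> gate list"
    and S :: "nat \<Rightarrow> nat set" and out :: "nat \<Rightarrow> real"
  assumes total: "\<And>k. (\<Sum>n<K * A k. (cmod (run_circuit K (A k) Or (gs k) n))\<^sup>2) = 1"
begin

abbreviation "alg \<equiv> round_alg A gs S out"

abbreviation "p k n \<equiv> outcome_prob K Or (Circuit (A k) (gs k)) n"

definition stop :: "nat \<Rightarrow> real" where
  "stop k = (\<Sum>n\<in>{..<K * A k} \<inter> S k. (cmod (run_circuit K (A k) Or (gs k) n))\<^sup>2)"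

definition stopped :: "nat list \<Rightarrow> bool" where
  "stopped h \<longleftrightarrow> h \<noteq> [] \<and> last h \<in> S (length h - 1)"

text \<open>Lists of in-range outcomes. They may continue beyond a stop; such continuations have
  probability 0.\<close>

fun hists :: "nat \<Rightarrow> nat list set" where
  "hists 0 = {[]}"
| "hists (Suc l) = (\<lambda>(h, n). h @ [n]) ` (hists l \<times> {..<K * A l})"

lemma length_hists: "h \<in> hists l \<Longrightarrow> length h = l"
  by (induction l arbitrary: h) auto

lemma finite_hists: "finite (hists l)"
  by (induction l) auto

lemma sum_p_stop: "(\<Sum>n\<in>{n \<in> {..<K * A k}. n \<in> S k}. p k n) = stop k"
  unfolding stop_def by (intro sum.cong) (auto simp: outcome_prob_def)

lemma sum_p: "(\<Sum>n<K * A k. p k n) = 1"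
  using total[of k] by (simp add: outcome_prob_def)

lemma sum_p_continue: "(\<Sum>n\<in>{n \<in> {..<K * A k}. n \<notin> S k}. p k n) = 1 - stop k"
proof -
  have "(\<Sum>n<K * A k. p k n) = (\<Sum>n\<in>{n \<in> {..<K * A k}. n \<in> S k}. p k n) + (\<Sum>n\<in>{n \<in> {..<K * A k}. n \<notin> S k}. p k n)"
    by (subst sum.union_disjoint[symmetric]) (auto intro!: sum.cong)
  then show ?thesis unfolding sum_p sum_p_stop by linarith
qed

lemma stop_range: "0 \<le> stop k" "stop k \<le> 1"
proof -
  show "0 \<le> stop k" unfolding stop_def by (intro sum_nonneg) simp
  have "0 \<le> (\<Sum>n\<in>{n \<in> {..<K * A k}. n \<notin> S k}. p k n)" by (intro sum_nonneg) (simp add: outcome_prob_nonneg)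
  then show "stop k \<le> 1" unfolding sum_p_continue by simp
qed

text \<open>The probability that none of the first \<open>l\<close> rounds stops, as
  \<open>sum_alive\<close> confirms.\<close>

definition alive :: "nat \<Rightarrow> real" where
  "alive l = (\<Prod>k<l. 1 - stop k)"

text \<open>The sum factorises because the circuit depends on the history through its length only,
  and because extensions of stopped histories have probability 0.\<close>

lemma sum_hists_Suc:
  "(\<Sum>h\<in>{h \<in> hists (Suc l). Q (last h)}. hist_prob alg K Or h) =
   (\<Sum>h\<in>{h \<in> hists l. \<not> stopped h}. hist_prob alg K Or h) * (\<Sum>n\<in>{n \<in> {..<K * A l}. Q n}. p l n)"
proof -
  have "{h \<in> hists (Suc l). Q (last h)} = (\<lambda>(h, n). h @ [n]) ` (hists l \<times> {n \<in> {..<K * A l}. Q n})"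
    by auto
  moreover have "inj_on (\<lambda>(h, n). h @ [n]) X" for X :: "(nat list \<times> nat) set"
    by (auto simp: inj_on_def)
  ultimately have "(\<Sum>h\<in>{h \<in> hists (Suc l). Q (last h)}. hist_prob alg K Or h) =
     (\<Sum>(h, n)\<in>hists l \<times> {n \<in> {..<K * A l}. Q n}. hist_prob alg K Or (h @ [n]))"
    by (simp add: sum.reindex case_prod_unfold)
  also have "\<dots> = (\<Sum>h\<in>hists l. \<Sum>n\<in>{n \<in> {..<K * A l}. Q n}. hist_prob alg K Or (h @ [n]))"
    by (subst sum.cartesian_product) simp
  also have "\<dots> = (\<Sum>h\<in>hists l. if \<not> stopped h then hist_prob alg K Or h * (\<Sum>n\<in>{n \<in> {..<K * A l}. Q n}. p l n) else 0)"
  proof (rule sum.cong[OF refl])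
    fix h assume "h \<in> hists l"
    then have "length h = l" by (rule length_hists)
    then have "outcome_prob K Or (alg h) n = (if stopped h then 0 else p l n)" for n
      by (auto simp: round_alg_def stopped_def outcome_prob_def)
    then show "(\<Sum>n\<in>{n \<in> {..<K * A l}. Q n}. hist_prob alg K Or (h @ [n])) =
        (if \<not> stopped h then hist_prob alg K Or h * (\<Sum>n\<in>{n \<in> {..<K * A l}. Q n}. p l n) else 0)"
      by (simp add: hist_prob_snoc sum_distrib_left)
  qed
  also have "\<dots> = (\<Sum>h\<in>{h \<in> hists l. \<not> stopped h}. hist_prob alg K Or h) * (\<Sum>n\<in>{n \<in> {..<K * A l}. Q n}. p l n)"
    by (simp add: sum.If_cases finite_hists sum_distrib_right Int_def)
  finally show ?thesis .
qed

lemma stopped_hists_Suc: "{h \<in> hists (Suc l). stopped h} = {h \<in> hists (Suc l). last h \<in> S l}"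
  "{h \<in> hists (Suc l). \<not> stopped h} = {h \<in> hists (Suc l). last h \<notin> S l}"
  by (auto simp: stopped_def dest: length_hists)

lemma sum_alive: "(\<Sum>h\<in>{h \<in> hists l. \<not> stopped h}. hist_prob alg K Or h) = alive l"
proof (induction l)
  case 0
  have "{h \<in> hists 0. \<not> stopped h} = {[]}" by (auto simp: stopped_def)
  then show ?case by (simp add: alive_def hist_prob_def)
next
  case (Suc l)
  then show ?case
    unfolding stopped_hists_Suc(2) sum_hists_Suc[of l "\<lambda>n. n \<notin> S l"] sum_p_continue by (simp add: alive_def)
qed

lemma sum_stopped: "(\<Sum>h\<in>{h \<in> hists (Suc l). stopped h}. hist_prob alg K Or h) = alive l * stop l"
  unfolding stopped_hists_Suc(1) sum_hists_Suc[of l "\<lambda>n. n \<in> S l"] sum_p_stop sum_alive ..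

lemma alive_Suc: "alive (Suc l) = alive l * (1 - stop l)"
  by (simp add: alive_def)

lemma alive_range: "0 \<le> alive l" "alive l \<le> 1"
  using stop_range by (auto simp: alive_def intro!: prod_nonneg prod_le_1)

lemma sum_alive_stop: "(\<Sum>k<l. alive k * stop k) = 1 - alive l"
  by (induction l) (simp_all add: alive_Suc alive_def[of 0] algebra_simps)

lemma hist_prob_outside: "h \<notin> hists (length h) \<Longrightarrow> hist_prob alg K Or h = 0"
proof (induction h rule: rev_induct)
  case (snoc n h)
  show ?case
  proof (cases "h \<in> hists (length h)")
    case True
    then have "\<not> n < K * A (length h)" using snoc.prems by auto
    then have "outcome_prob K Or (alg h) n = 0" by (auto simp: round_alg_def outcome_prob_def)
    then show ?thesis by (simp add: hist_prob_snoc)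
  qed (simp add: hist_prob_snoc snoc.IH)
qed simp

text \<open>\<open>success_prob\<close> is a supremum of finite sums. The histories that first stop
  after a round in \<open>G\<close> carry the probability \<open>alive k * stop k\<close> each round
  and form one such finite family, up to members of probability 0.\<close>

lemma success_prob_ge:
  assumes "finite G" "\<And>k. k \<in> G \<Longrightarrow> P (out k)"
  shows "ennreal (\<Sum>k\<in>G. alive k * stop k) \<le> success_prob alg K Or P"
proof -
  let ?g = "\<lambda>h. case alg h of Output r \<Rightarrow> (if P r then ennreal (hist_prob alg K Or h) else 0)
                              | Circuit _ _ \<Rightarrow> 0"
  let ?H = "\<lambda>k. {h \<in> hists (Suc k). stopped h}"
  have fin: "finite (?H k)" for k using finite_hists[of "Suc k"] by simp
  have g: "?g h = ennreal (hist_prob alg K Or h)" if "k \<in> G" "h \<in> ?H k" for k h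
  proof -
    have "length h = Suc k" using that length_hists by blast
    moreover have "stopped h" using that by blast
    ultimately have "alg h = Output (out k)" by (simp add: round_alg_def stopped_def)
    then show ?thesis using assms(2)[OF that(1)] by simp
  qed
  have "ennreal (\<Sum>k\<in>G. alive k * stop k) = ennreal (\<Sum>k\<in>G. \<Sum>h\<in>?H k. hist_prob alg K Or h)"
    by (simp only: sum_stopped)
  also have "\<dots> = (\<Sum>k\<in>G. ennreal (\<Sum>h\<in>?H k. hist_prob alg K Or h))"
    by (intro sum_ennreal[symmetric] sum_nonneg hist_prob_nonneg)
  also have "\<dots> = (\<Sum>k\<in>G. \<Sum>h\<in>?H k. ennreal (hist_prob alg K Or h))"
    by (intro sum.cong refl sum_ennreal[symmetric] hist_prob_nonneg)
  also have "\<dots> = (\<Sum>k\<in>G. \<Sum>h\<in>?H k. ?g h)" by (intro sum.cong refl) (simp add: g)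
  also have "\<dots> = (\<Sum>h\<in>(\<Union>k\<in>G. ?H k). ?g h)"
    by (rule sum.UNION_disjoint[symmetric]) (use assms(1) fin in \<open>auto dest!: length_hists\<close>)
  also have "\<dots> \<le> success_prob alg K Or P"
    unfolding success_prob_def nn_sum_def by (rule SUP_upper) (use assms(1) fin in auto)
  finally show ?thesis .
qed

lemma expected_queries_le:
  assumes "\<And>n. (\<Sum>l<n. alive l * real (count_queries (gs l))) \<le> B"
  shows "expected_queries alg K Or \<le> ennreal B"
  unfolding expected_queries_def nn_sum_def
proof (rule SUP_least)
  fix F :: "nat list set" assume "F \<in> {F. finite F}"
  then have F: "finite F" by simp
  \<comment> \<open>A strict bound on all lengths in \<open>F\<close>; the inserted 0 covers the
    empty set.\<close>
  define n where "n = Suc (Max (insert 0 (length ` F)))"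
  have len: "length h < n" if "h \<in> F" for h
    unfolding n_def by (rule le_imp_less_Suc, rule Max_ge) (use F that in auto)
  let ?q = "\<lambda>h. hist_prob alg K Or h * real (num_queries (alg h))"
  let ?H = "\<lambda>l. {h \<in> hists l. \<not> stopped h}"
  have q0: "0 \<le> ?q h" for h by (simp add: hist_prob_nonneg)
  have fin: "finite (\<Union>l<n. ?H l)" using finite_hists by auto
  have "(\<Sum>h\<in>F. ?q h) = (\<Sum>h\<in>F \<inter> (\<Union>l<n. ?H l). ?q h)"
  proof (rule sum.mono_neutral_right[OF F])
    show "\<forall>h\<in>F - F \<inter> (\<Union>l<n. ?H l). ?q h = 0"
    proof
      fix h assume h: "h \<in> F - F \<inter> (\<Union>l<n. ?H l)"
      then have "h \<notin> hists (length h) \<or> stopped h" using len by blast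
      then show "?q h = 0"
      proof
        assume "stopped h"
        then show ?thesis by (simp add: round_alg_def stopped_def num_queries_def)
      qed (simp add: hist_prob_outside)
    qed
  qed auto
  also have "\<dots> \<le> (\<Sum>h\<in>(\<Union>l<n. ?H l). ?q h)" by (rule sum_mono2[OF fin]) (use q0 in auto)
  also have "\<dots> = (\<Sum>l<n. \<Sum>h\<in>?H l. ?q h)"
    by (rule sum.UNION_disjoint) (use finite_hists in \<open>auto dest!: length_hists\<close>)
  also have "\<dots> = (\<Sum>l<n. \<Sum>h\<in>?H l. hist_prob alg K Or h * real (count_queries (gs l)))"
  proof (intro sum.cong refl)
    fix l h assume h: "h \<in> ?H l"
    then have "alg h = Circuit (A l) (gs l)" using length_hists[of h l] by (auto simp: round_alg_def stopped_def)
    then show "?q h = hist_prob alg K Or h * real (count_queries (gs l))"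
      by (simp add: num_queries_def count_queries_def)
  qed
  also have "\<dots> = (\<Sum>l<n. alive l * real (count_queries (gs l)))"
    by (simp only: sum_distrib_right[symmetric] sum_alive)
  also have "\<dots> \<le> B" by (rule assms)
  finally have "ennreal (\<Sum>h\<in>F. ?q h) \<le> ennreal B" by (rule ennreal_leI)
  then show "(\<Sum>h\<in>F. ennreal (?q h)) \<le> ennreal B" by (simp add: sum_ennreal q0)
qed

end

section \<open>The algorithm\<close>

text \<open>Chosen such that a flagged probability of at least \<open>1 / (4 * N)\<close> gives an angle of at least
  \<open>8 * pi / 2 ^ search_exp N\<close>.\<close>
definition search_exp :: "nat \<Rightarrow> nat" where
  "search_exp N = nat \<lceil>log 2 (32 * sqrt (real N))\<rceil>"

text \<open>Chosen such that \<open>2 ^ boost_exp k\<close> is at least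
  \<open>16 * (k + 2)^2\<close>: the error of round \<open>k\<close> is then at most
  \<open>1 / (4 * (k + 2)^2)\<close>, and all errors sum to at most \<open>1 / 4\<close>.\<close>

definition boost_exp :: "nat \<Rightarrow> nat" where
  "boost_exp k = 4 + 2 * nat \<lceil>log 2 (real k + 2)\<rceil>"

lemma pow_nat_ceiling_log:
  assumes "x \<ge> 1"
  shows "x \<le> 2 ^ nat \<lceil>log 2 x\<rceil>" "2 ^ nat \<lceil>log 2 x\<rceil> \<le> 2 * x" "real (nat \<lceil>log 2 x\<rceil>) \<le> log 2 x + 1"
proof -
  have l: "0 \<le> log 2 x" using assms by simp
  have p: "(2::real) ^ nat \<lceil>log 2 x\<rceil> = 2 powr real (nat \<lceil>log 2 x\<rceil>)" by (simp add: powr_realpow)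
  have u: "real (nat \<lceil>log 2 x\<rceil>) \<le> log 2 x + 1" and v: "log 2 x \<le> real (nat \<lceil>log 2 x\<rceil>)"
    using l by linarith+
  show "real (nat \<lceil>log 2 x\<rceil>) \<le> log 2 x + 1" by (rule u)
  have "x = 2 powr (log 2 x)" using assms by simp
  also have "\<dots> \<le> 2 powr real (nat \<lceil>log 2 x\<rceil>)" using v by simp
  finally show "x \<le> 2 ^ nat \<lceil>log 2 x\<rceil>" by (simp only: p)
  have "2 powr real (nat \<lceil>log 2 x\<rceil>) \<le> 2 powr (log 2 x + 1)" using u by simp
  also have "\<dots> = 2 * x" using assms by (simp add: powr_add)
  finally show "2 ^ nat \<lceil>log 2 x\<rceil> \<le> 2 * x" by (simp only: p)
qed

lemma search_exp:
  assumes "N \<ge> 1"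
  shows "32 * sqrt (real N) \<le> 2 ^ search_exp N" "2 ^ search_exp N \<le> 64 * sqrt (real N)" "2 \<le> search_exp N"
proof -
  have "1 \<le> sqrt (real N)" using assms by simp
  then have x: "1 \<le> 32 * sqrt (real N)" by linarith
  show "32 * sqrt (real N) \<le> 2 ^ search_exp N" "2 ^ search_exp N \<le> 64 * sqrt (real N)"
    using pow_nat_ceiling_log[OF x] by (simp_all add: search_exp_def)
  have "(2::real) ^ 2 \<le> 32 * sqrt (real N)" using \<open>1 \<le> sqrt (real N)\<close> by (simp only: power2_eq_square)
  also have "\<dots> \<le> 2 ^ search_exp N" by fact
  finally have "(2::real) ^ 2 \<le> 2 ^ search_exp N" .
  then show "2 \<le> search_exp N" by (rule power_le_imp_le_exp[rotated]) simp
qed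

lemma boost_exp_error: "4 / 2 ^ boost_exp k \<le> 1 / (4 * (real k + 2)\<^sup>2)"
proof -
  have "real k + 2 \<le> 2 ^ nat \<lceil>log 2 (real k + 2)\<rceil>" by (rule pow_nat_ceiling_log) simp
  then have "(real k + 2)\<^sup>2 \<le> (2 ^ nat \<lceil>log 2 (real k + 2)\<rceil>)\<^sup>2" by (intro power_mono) auto
  then have "16 * (real k + 2)\<^sup>2 \<le> 2 ^ boost_exp k"
    by (simp add: boost_exp_def power_add power_mult[symmetric] mult.commute)
  moreover have "0 < (real k + 2)\<^sup>2" by (intro zero_less_power) simp
  ultimately have "4 / 2 ^ boost_exp k \<le> 4 / (16 * (real k + 2)\<^sup>2)" by (intro divide_left_mono) auto
  then show ?thesis by simp
qed

text \<open>As \<open>k + 3 \<le> 2 * (k + 2)\<close>, the rounded logarithm grows by at most 1 per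
  round.\<close>

lemma boost_exp_Suc: "boost_exp k \<le> boost_exp (Suc k)" "boost_exp (Suc k) \<le> 2 * boost_exp k"
proof -
  have "log 2 (real k + 2) \<le> log 2 (real (Suc k) + 2)" by simp
  then have "\<lceil>log 2 (real k + 2)\<rceil> \<le> \<lceil>log 2 (real (Suc k) + 2)\<rceil>" by (rule ceiling_mono)
  then show "boost_exp k \<le> boost_exp (Suc k)" 
    using nat_mono unfolding boost_exp_def by (meson add_left_mono mult_le_mono2)
  have "log 2 (real (Suc k) + 2) \<le> log 2 (2 * (real k + 2))" by simp
  also have "\<dots> = log 2 (real k + 2) + 1" by (subst log_mult) auto
  finally have "\<lceil>log 2 (real (Suc k) + 2)\<rceil> \<le> \<lceil>log 2 (real k + 2) + 1\<rceil>" by (rule ceiling_mono)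
  then have "\<lceil>log 2 (real (Suc k) + 2)\<rceil> \<le> \<lceil>log 2 (real k + 2)\<rceil> + 1" by simp
  then have "nat \<lceil>log 2 (real (Suc k) + 2)\<rceil> \<le> nat \<lceil>log 2 (real k + 2)\<rceil> + 1" by linarith
  moreover have "4 + 2 * a \<le> 2 * (4 + 2 * b)" if "a \<le> b + 1" for a b :: nat using that by simp
  ultimately show "boost_exp (Suc k) \<le> 2 * boost_exp k" unfolding boost_exp_def by blast
qed

definition round_circ :: "nat \<Rightarrow> nat \<Rightarrow> nat \<Rightarrow> gate list" where
  "round_circ N m k = outer_circ N m (2 * search_exp N) (2 ^ (k + 1)) (boost_exp k) (2 ^ search_exp N)"

definition round_dim :: "nat \<Rightarrow> nat \<Rightarrow> nat" where
  "round_dim N k = 2 * search_exp N * 2 ^ (k + 1) * (boost_exp k * 2 ^ search_exp N)"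

definition round_stop :: "nat \<Rightarrow> nat \<Rightarrow> nat set" where
  "round_stop N k = {n. n mod (boost_exp k * 2 ^ search_exp N) \<in> window (boost_exp k) (2 ^ search_exp N)}"

definition bias_alg :: "nat \<Rightarrow> nat \<Rightarrow> strategy" where
  "bias_alg N m = round_alg (round_dim N) (round_circ N m) (round_stop N) (\<lambda>k. 1 / 2 ^ (k + 1))"

lemma boost_exp_pos: "0 < boost_exp k"
  by (simp add: boost_exp_def)

lemma valid_round_circ:
  assumes "N \<ge> 1" shows "valid_circ (oracle_dim N m * round_dim N k) (round_circ N m k)"
  unfolding round_circ_def round_dim_def
  by (rule valid_circ_outer) (use assms search_exp(3)[OF assms] boost_exp_pos in auto)

lemma round_dim_pos: "N \<ge> 1 \<Longrightarrow> 0 < round_dim N k"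
  using search_exp(3)[of N] boost_exp_pos[of k] by (simp add: round_dim_def)

lemma valid_bias_alg:
  assumes "N \<ge> 1" shows "valid_strategy (bias_alg N m) (oracle_dim N m)"
  using valid_round_circ[OF assms] round_dim_pos[OF assms]
  by (auto simp: valid_strategy_def bias_alg_def round_alg_def valid_circ_def Suc_le_eq split: if_splits)

section \<open>Success probability of the algorithm\<close>

context biased
begin

sublocale rounds K Or "round_dim N" "round_circ N m" "round_stop N" "\<lambda>k. 1 / 2 ^ (k + 1)"
  by unfold_locales
    (rule sum_run_circuit, use valid_round_circ[OF N] round_dim_pos[OF N] oracle_dim_pos[OF N] in auto)

abbreviation "E \<equiv> eps_min N m f Or"

definition err :: "nat \<Rightarrow> real" where
  "err k = 1 / (4 * (real k + 2)\<^sup>2)"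

lemma stop_eq: "stop k = stop_prob (2 * search_exp N) (2 ^ (k + 1)) (boost_exp k) (2 ^ search_exp N)"
  by (simp add: stop_def stop_prob_def round_dim_def round_stop_def round_circ_def)

lemma eps_min: "x < N \<Longrightarrow> E \<le> eps_x m f Or x" "\<exists>x<N. E = eps_x m f Or x" "0 < E" "E \<le> 1 / 2"
proof -
  have ne: "eps_x m f Or ` {..<N} \<noteq> {}" using N by (auto simp: lessThan_empty_iff)
  show "E \<le> eps_x m f Or x" if "x < N" unfolding eps_min_def using that by (intro Min_le) auto
  have "E \<in> eps_x m f Or ` {..<N}" unfolding eps_min_def by (rule Min_in[OF _ ne]) simp
  then obtain x where x: "x < N" "E = eps_x m f Or x" by auto
  then show "\<exists>x<N. E = eps_x m f Or x" by blast
  show "0 < E" "E \<le> 1 / 2" using x eps_x_pos signed_norm(2) by auto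
qed

lemma stop_le_err:
  assumes "E \<le> 1 / 2 ^ (k + 1)" shows "stop k \<le> err k"
proof -
  obtain x where x: "x < N" "E = eps_x m f Or x" using eps_min(2) by blast
  have "stop k \<le> 4 / 2 ^ boost_exp k"
    unfolding stop_eq
    by (rule stop_prob_le[OF refl search_exp(3,1)[OF N] _ boost_exp_pos x(1)]) (use assms x in auto)
  then show ?thesis using boost_exp_error[of k] by (simp add: err_def)
qed

lemma stop_ge_err:
  assumes "2 * pi / 2 ^ (k + 1) \<le> E" shows "1 - stop k \<le> err k"
proof -
  have "1 - 4 / 2 ^ boost_exp k \<le> stop k"
    unfolding stop_eq
    by (rule stop_prob_ge[OF refl search_exp(3)[OF N] _ boost_exp_pos])
      (use assms eps_min(1) in \<open>auto intro: order_trans\<close>)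
  then show ?thesis using boost_exp_error[of k] by (simp add: err_def)
qed

lemma err_nonneg: "0 \<le> err k" by (simp add: err_def)

lemma sum_err_le: "(\<Sum>k\<le>n. err k) \<le> 1 / 4"
proof -
  have "(\<Sum>k\<le>n. err k) = (\<Sum>j\<in>{1<..n + 2}. 1 / (real j)\<^sup>2) / 4"
    unfolding sum_divide_distrib err_def
    by (rule sum.reindex_bij_witness[where i = "\<lambda>j. j - 2" and j = "\<lambda>k. k + 2"]) auto
  also have "(\<Sum>j\<in>{1<..n + 2}. 1 / (real j)\<^sup>2) \<le> 1 / real 1 - 1 / real (n + 2)"
    by (rule sum_inverse_squares_tail) auto
  also have "\<dots> \<le> 1" by simp
  finally show ?thesis by simp
qed

lemma err_le: "err k \<le> 1 / 16"
proof -
  have "2\<^sup>2 \<le> (real k + 2)\<^sup>2" by (rule power_mono) auto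
  then show ?thesis unfolding err_def by (intro divide_left_mono) auto
qed

text \<open>The first round in which all biases exceed the upper threshold, so that stopping is
  nearly certain; minimality bounds \<open>E\<close> from above by twice that threshold.\<close>

definition last_round :: nat where
  "last_round = (LEAST k. 2 * pi / 2 ^ (k + 1) \<le> E)"

lemma last_round:
  "2 * pi / 2 ^ (last_round + 1) \<le> E" "E < 4 * pi / 2 ^ (last_round + 1)"
proof -
  have "\<exists>k. 2 * pi / 2 ^ (k + 1) \<le> E"
  proof -
    obtain k where "2 * pi / E < 2 ^ k" using real_arch_pow[of 2 "2 * pi / E"] by auto
    then have "2 * pi < E * 2 ^ k" using eps_min(3) by (simp add: field_simps)
    also have "\<dots> \<le> E * 2 ^ (k + 1)" using eps_min(3) by (intro mult_left_mono) auto
    finally have "2 * pi / 2 ^ (k + 1) \<le> E" by (simp add: field_simps)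
    then show ?thesis by blast
  qed
  then show l: "2 * pi / 2 ^ (last_round + 1) \<le> E"
    unfolding last_round_def by (rule LeastI_ex)
  show "E < 4 * pi / 2 ^ (last_round + 1)"
  proof (cases last_round)
    \<comment> \<open>Round 0 cannot be the last one, since this would mean
      \<open>pi \<le> E\<close> while \<open>E \<le> 1 / 2\<close>.\<close>
    case 0
    then have "pi \<le> E" using l by simp
    then show ?thesis using eps_min(4) pi_gt3 by simp
  next
    case (Suc k)
    then have "\<not> 2 * pi / 2 ^ (k + 1) \<le> E"
      using not_less_Least[of k "\<lambda>k. 2 * pi / 2 ^ (k + 1) \<le> E"] unfolding last_round_def by simp
    then show ?thesis unfolding Suc by simp
  qed
qed

text \<open>Failure means stopping in a round of \<open>B\<close>, where \<open>1 / L\<close> is not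
  below \<open>E\<close>, or surviving \<open>last_round\<close>. Together this has probability at
  most \<open>1 / 4\<close>. Stopping in any other round up to \<open>last_round\<close> gives an
  output between \<open>E / (4 * pi)\<close> and \<open>E\<close>.\<close>

lemma success:
  "ennreal (2 / 3) \<le> success_prob (bias_alg N m) K Or (\<lambda>r. E / (5 * pi\<^sup>2) \<le> r \<and> r \<le> E)"
proof -
  define B where "B = {k. k \<le> last_round \<and> E \<le> 1 / 2 ^ (k + 1)}"
  define G where "G = {..last_round} - B"
  \<comment> \<open>Since \<open>last_round\<close> is not in \<open>B\<close>, its error is still
    available to bound the probability of surviving it.\<close>
  have B: "B \<subseteq> {..<last_round}"
  proof -
    have "1 / 2 ^ (last_round + 1) < 2 * pi / 2 ^ (last_round + 1)"
      using pi_gt3 by (intro divide_strict_right_mono) auto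
    then have "1 / 2 ^ (last_round + 1) < E" using last_round(1) by linarith
    then have "last_round \<notin> B" by (simp add: B_def)
    then show ?thesis by (force simp: B_def le_less)
  qed
  have "(\<Sum>k\<in>B. alive k * stop k) \<le> (\<Sum>k\<in>B. 1 * err k)"
    by (intro sum_mono mult_mono alive_range stop_range stop_le_err) (auto simp: B_def)
  also have "\<dots> \<le> (\<Sum>k<last_round. err k)"
    using B by (auto intro!: sum_mono2 err_nonneg)
  finally have b: "(\<Sum>k\<in>B. alive k * stop k) \<le> (\<Sum>k<last_round. err k)" .
  have "alive (Suc last_round) \<le> 1 * err last_round"
    unfolding alive_Suc
    by (intro mult_mono alive_range stop_ge_err last_round(1)) (use stop_range in auto)
  moreover have "(\<Sum>k\<in>{..last_round}. alive k * stop k) = (\<Sum>k\<in>G. alive k * stop k) + (\<Sum>k\<in>B. alive k * stop k)"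
    unfolding G_def using B by (intro sum.subset_diff) auto
  moreover have "(\<Sum>k\<in>{..last_round}. alive k * stop k) = 1 - alive (Suc last_round)"
    using sum_alive_stop[of "Suc last_round"] by (simp only: lessThan_Suc_atMost)
  moreover have "(\<Sum>k<last_round. err k) + err last_round \<le> 1 / 4"
    using sum_err_le[of last_round] by (simp add: lessThan_Suc_atMost[symmetric])
  ultimately have "2 / 3 \<le> (\<Sum>k\<in>G. alive k * stop k)" using b by linarith
  then have "ennreal (2 / 3) \<le> ennreal (\<Sum>k\<in>G. alive k * stop k)" by (rule ennreal_leI)
  also have "\<dots> \<le> success_prob (bias_alg N m) K Or (\<lambda>r. E / (5 * pi\<^sup>2) \<le> r \<and> r \<le> E)"
    unfolding bias_alg_def
  proof (rule success_prob_ge)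
    show "finite G" by (simp add: G_def)
    fix k assume "k \<in> G"
    then have k: "k \<le> last_round" "1 / 2 ^ (k + 1) < E" by (auto simp: G_def B_def)
    have "4 * pi \<le> 5 * pi\<^sup>2" using pi_gt3 by (simp add: power2_eq_square)
    then have "E / (5 * pi\<^sup>2) \<le> E / (4 * pi)" using eps_min(3) by (intro divide_left_mono) auto
    also have "\<dots> \<le> 1 / 2 ^ (last_round + 1)" using last_round(2) by (simp add: field_simps)
    also have "\<dots> \<le> 1 / 2 ^ (k + 1)" using k by (intro divide_left_mono power_increasing) auto
    finally show "E / (5 * pi\<^sup>2) \<le> 1 / 2 ^ (k + 1) \<and> 1 / 2 ^ (k + 1) \<le> E" using k by simp
  qed
  finally show ?thesis .
qed

section \<open>Expected number of queries\<close>

lemma count_round_circ: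
  "count_queries (round_circ N m k) = 16 * search_exp N * 2 ^ search_exp N * 2 ^ (k + 1) * boost_exp k"
  by (simp add: round_circ_def count_queries_outer)

abbreviation "Q k \<equiv> real (count_queries (round_circ N m k))"

text \<open>The inner clock doubles from round to round, while the boosting exponent grows by a
  factor between 1 and 2.\<close>

lemma Q_Suc: "2 * Q k \<le> Q (Suc k)" "Q (Suc k) \<le> 4 * Q k"
proof -
  define c where "c = real (16 * search_exp N * 2 ^ search_exp N * 2 ^ (k + 1))"
  have q: "Q k = c * real (boost_exp k)" "Q (Suc k) = c * (2 * real (boost_exp (Suc k)))"
    by (simp_all add: count_round_circ c_def)
  have "0 \<le> c" by (simp add: c_def)
  moreover have "real (boost_exp k) \<le> real (boost_exp (Suc k))"
    "real (boost_exp (Suc k)) \<le> 2 * real (boost_exp k)"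
    using boost_exp_Suc[of k] by linarith+
  ultimately show "2 * Q k \<le> Q (Suc k)" "Q (Suc k) \<le> 4 * Q k"
    using mult_left_mono[of "real (boost_exp k)" "real (boost_exp (Suc k))" c]
      mult_left_mono[of "real (boost_exp (Suc k))" "2 * real (boost_exp k)" c]
    unfolding q by linarith+
qed

lemma sum_Q: "(\<Sum>k\<le>n. Q k) \<le> 2 * Q n"
proof (induction n)
  case (Suc n)
  then show ?case using Q_Suc(1)[of n] by simp
qed simp

text \<open>From \<open>last_round\<close> on each round is survived with probability at most
  \<open>1 / 16\<close>, while the cost grows at most fourfold.\<close>

lemma alive_Q: "alive (last_round + j) * Q (last_round + j) \<le> (1 / 4) ^ j * Q last_round"
proof (induction j)
  case 0
  show ?case using mult_right_mono[OF alive_range(2), of "Q last_round"] by simp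
next
  case (Suc j)
  let ?k = "last_round + j"
  have "(2::real) ^ (last_round + 1) \<le> 2 ^ (?k + 1)" by (intro power_increasing) auto
  then have "2 * pi / 2 ^ (?k + 1) \<le> 2 * pi / 2 ^ (last_round + 1)" by (intro divide_left_mono) auto
  then have "1 - stop ?k \<le> err ?k" using last_round(1) by (intro stop_ge_err) linarith
  then have s: "1 - stop ?k \<le> 1 / 16" using err_le[of ?k] by linarith
  have "alive (Suc ?k) * Q (Suc ?k) \<le> (alive ?k * (1 / 16)) * (4 * Q ?k)"
    unfolding alive_Suc using s Q_Suc(2)[of ?k] stop_range(2)[of ?k] by (intro mult_mono alive_range mult_nonneg_nonneg) auto
  also have "\<dots> = (1 / 4) * (alive ?k * Q ?k)" by simp
  also have "\<dots> \<le> (1 / 4) * ((1 / 4) ^ j * Q last_round)" using Suc by (intro mult_left_mono) auto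
  finally show ?case by simp
qed

text \<open>Rounds up to \<open>last_round\<close> count in full and add up to at most twice the
  last cost, by geometric growth; the later ones form a decreasing geometric series.\<close>

lemma sum_alive_Q: "(\<Sum>l<n. alive l * Q l) \<le> 3 * Q last_round"
proof -
  have nn: "0 \<le> alive l * Q l" for l using alive_range(1) by simp
  have "(\<Sum>l<n. alive l * Q l) \<le> (\<Sum>l<Suc last_round + n. alive l * Q l)"
    using nn by (intro sum_mono2) auto
  also have "\<dots> = (\<Sum>l\<le>last_round. alive l * Q l) + (\<Sum>j<n. alive (Suc last_round + j) * Q (Suc last_round + j))"
  proof -
    have "(\<Sum>l<a + n. g l) = (\<Sum>l<a. g l) + (\<Sum>j<n. g (a + j))" for a n and g :: "nat \<Rightarrow> real"
      by (induction n) simp_all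
    then show ?thesis by (simp only: lessThan_Suc_atMost)
  qed
  also have "(\<Sum>l\<le>last_round. alive l * Q l) \<le> (\<Sum>l\<le>last_round. 1 * Q l)"
    by (intro sum_mono mult_right_mono alive_range) auto
  also have "\<dots> \<le> 2 * Q last_round" using sum_Q by simp
  also have "(\<Sum>j<n. alive (Suc last_round + j) * Q (Suc last_round + j)) \<le> (\<Sum>j<n. (1 / 4) ^ Suc j * Q last_round)"
  proof (rule sum_mono)
    fix j
    show "alive (Suc last_round + j) * Q (Suc last_round + j) \<le> (1 / 4) ^ Suc j * Q last_round"
      using alive_Q[of "Suc j"] by simp
  qed
  also have "\<dots> = (\<Sum>j<n. (1 / 4) ^ Suc j) * Q last_round" by (simp only: sum_distrib_right)
  also have "\<dots> \<le> 1 * Q last_round"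
  proof (rule mult_right_mono)
    have "(\<Sum>j<n. (1 / 4 :: real) ^ Suc j) = (1 - (1 / 4) ^ n) / 3" by (induction n) simp_all
    also have "\<dots> \<le> 1"
    proof -
      have third: "(1 - x) / 3 \<le> 1" if "0 \<le> x" for x :: real using that by simp
      show ?thesis by (rule third) simp
    qed
    finally show "(\<Sum>j<n. (1 / 4 :: real) ^ Suc j) \<le> 1" .
  qed simp
  finally show ?thesis by simp
qed

lemma log2_le:
  assumes "1 \<le> x" shows "log 2 x \<le> 2 * ln x"
proof -
  have l: "1 / 2 \<le> ln (2::real)" using ln2_ge_two_thirds by simp
  have "log 2 x = ln x / ln 2" by (simp add: log_def)
  also have "\<dots> \<le> ln x / (1 / 2)" using assms l by (intro divide_left_mono) auto
  finally show ?thesis by simp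
qed

lemma search_exp_le: "real (search_exp N) \<le> 7 * max 1 (ln (real N))"
proof -
  have n: "1 \<le> sqrt (real N)" using N by simp
  then have "real (search_exp N) \<le> log 2 (32 * sqrt (real N)) + 1"
    unfolding search_exp_def by (intro pow_nat_ceiling_log) linarith
  also have "log 2 (32 * sqrt (real N)) = log 2 (2 ^ 5) + log 2 (sqrt (real N))"
    using N by (subst log_mult) auto
  also have "log 2 (2 ^ 5 :: real) = 5" by (subst log_nat_power) auto
  also have "log 2 (sqrt (real N)) \<le> 2 * ln (sqrt (real N))" by (rule log2_le[OF n])
  also have "2 * ln (sqrt (real N)) = ln (real N)" using N by (simp add: ln_sqrt)
  finally show ?thesis by linarith
qed

text \<open>\<open>2 ^ (last_round + 1)\<close> is at most \<open>16 / E\<close>, so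
  \<open>last_round\<close> is of order \<open>ln (1 / E)\<close>, and the boosting exponent takes
  one more logarithm.\<close>

lemma boost_exp_last_round: "real (boost_exp last_round) \<le> 20 * max 1 (ln (ln (1 / E)))"
proof -
  define y where "y = ln (1 / E)"
  define M where "M = max 1 (ln y)"
  have e2: "2 \<le> 1 / E" using eps_min(3,4) by (simp add: field_simps)
  have "ln 2 \<le> y" unfolding y_def using e2 by (intro ln_mono) auto
  then have y: "1 / 2 \<le> y" using ln2_ge_two_thirds by simp
  have "2 ^ (last_round + 1) \<le> 4 * pi / E"
    using last_round(2) eps_min(3) by (simp add: field_simps)
  also have "\<dots> \<le> 16 / E" using pi_less_4 eps_min(3) by (intro divide_right_mono) auto
  finally have "log 2 (2 ^ (last_round + 1)) \<le> log 2 (2 ^ 4 * (1 / E))"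
    using eps_min(3) by (intro log_mono) auto
  also have "\<dots> = log 2 (2 ^ 4) + log 2 (1 / E)" using eps_min(3) by (subst log_mult) auto
  also have "log 2 (2 ^ 4 :: real) = 4" by (subst log_nat_power) auto
  also have "log 2 (2 ^ (last_round + 1) :: real) = real (last_round + 1)" by (subst log_nat_power) auto
  also have "log 2 (1 / E) \<le> 2 * y" unfolding y_def by (rule log2_le) (use e2 in simp)
  \<comment> \<open>The bound \<open>1 / 2 \<le> y\<close> absorbs the additive constants.\<close>
  finally have k: "real last_round + 2 \<le> 2 ^ 4 * y" using y by simp
  have "log 2 (real last_round + 2) \<le> log 2 (2 ^ 4 * y)" using k by simp
  also have "\<dots> = log 2 (2 ^ 4) + log 2 y" using y by (subst log_mult) auto
  also have "log 2 (2 ^ 4 :: real) = 4" by (subst log_nat_power) auto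
  also have "log 2 y \<le> 2 * M"
  proof (cases "1 \<le> y")
    case True
    then show ?thesis using log2_le[of y] by (simp add: M_def)
  next
    case False
    then have "log 2 y \<le> 0" using y by simp
    then show ?thesis by (simp add: M_def)
  qed
  finally have "log 2 (real last_round + 2) \<le> 4 + 2 * M" by simp
  moreover have "real (nat \<lceil>log 2 (real last_round + 2)\<rceil>) \<le> log 2 (real last_round + 2) + 1"
    by (rule pow_nat_ceiling_log) simp
  ultimately have "real (boost_exp last_round) \<le> 14 + 4 * M"
    by (simp only: boost_exp_def of_nat_add of_nat_mult of_nat_numeral)
  also have "\<dots> \<le> 20 * M" by (simp add: M_def)
  finally show ?thesis by (simp add: M_def y_def)
qed

lemma queries:
  "expected_queries (bias_alg N m) K Or \<le> ennreal (6881280 * sqrt (real N) * max 1 (ln (real N)) / E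
     * max 1 (ln (ln (1 / E))))"
proof -
  define a where "a = max 1 (ln (real N))"
  define b where "b = max 1 (ln (ln (1 / E)))"
  have pos: "0 \<le> a" "0 \<le> b" "0 < E" using eps_min(3) by (auto simp: a_def b_def)
  have l: "2 ^ (last_round + 1) \<le> 16 / E"
  proof -
    have "2 ^ (last_round + 1) \<le> 4 * pi / E" using last_round(2) pos by (simp add: field_simps)
    also have "\<dots> \<le> 16 / E" using pi_less_4 pos by (intro divide_right_mono) auto
    finally show ?thesis .
  qed
  have "3 * Q last_round = 48 * real (search_exp N) * 2 ^ search_exp N * 2 ^ (last_round + 1) * real (boost_exp last_round)"
    by (simp add: count_round_circ)
  \<comment> \<open>Factor by factor: \<open>log N\<close> from the inner boosting,
    \<open>sqrt N\<close> from the outer clock, \<open>1 / E\<close> from the inner clock and the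
    iterated logarithm from the outer boosting. The constants multiply to 6881280.\<close>
  also have "\<dots> \<le> 48 * (7 * a) * (64 * sqrt (real N)) * (16 / E) * (20 * b)"
    using search_exp_le boost_exp_last_round l search_exp(2)[OF N] pos
    by (intro mult_mono mult_nonneg_nonneg) (auto simp: a_def b_def)
  also have "\<dots> = 6881280 * sqrt (real N) * a / E * b" by simp
  finally have "3 * Q last_round \<le> 6881280 * sqrt (real N) * a / E * b" .
  then have "(\<Sum>l<n. alive l * Q l) \<le> 6881280 * sqrt (real N) * a / E * b" for n
    using sum_alive_Q[of n] by linarith
  then show ?thesis unfolding bias_alg_def a_def b_def by (rule expected_queries_le)
qed

end

text \<open>The constant and the family of strategies are fixed before \<open>f\<close>,
  \<open>\<epsilon>\<close> and the oracle, which expresses that nothing is known about the bias.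
  \<open>max 1\<close> keeps the bound meaningful where a logarithm is small or negative.\<close>

theorem theorem4:
  shows "\<exists>C>0. \<exists>alg :: nat \<Rightarrow> nat \<Rightarrow> strategy.
    (\<forall>N\<ge>1. \<forall>m\<ge>1. valid_strategy (alg N m) (oracle_dim N m)) \<and>
    (\<forall>N\<ge>1. \<forall>m\<ge>1. \<forall>(f :: nat \<Rightarrow> bool) (\<epsilon> :: real) (Or :: cmat).
       0 < \<epsilon> \<longrightarrow> biased_oracle N m f \<epsilon> Or \<longrightarrow>
       success_prob (alg N m) (oracle_dim N m) Or
         (\<lambda>r. eps_min N m f Or / (5 * pi\<^sup>2) \<le> r \<and> r \<le> eps_min N m f Or) \<ge> ennreal (2 / 3) \<and>
       expected_queries (alg N m) (oracle_dim N m) Or \<le>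
         ennreal (C * sqrt (real N) * max 1 (ln (real N)) / eps_min N m f Or
                   * max 1 (ln (ln (1 / eps_min N m f Or)))))"
proof (intro exI conjI allI impI)
  show "(0::real) < 6881280" by simp
  fix N m :: nat assume N: "1 \<le> N" and m: "1 \<le> m"
  show "valid_strategy (bias_alg N m) (oracle_dim N m)" by (rule valid_bias_alg[OF N])
  fix f :: "nat \<Rightarrow> bool" and \<epsilon> :: real and Or :: cmat
  assume "0 < \<epsilon>" "biased_oracle N m f \<epsilon> Or"
  then interpret biased N m f \<epsilon> Or using N m by unfold_locales
  show "ennreal (2 / 3) \<le> success_prob (bias_alg N m) (oracle_dim N m) Or
         (\<lambda>r. eps_min N m f Or / (5 * pi\<^sup>2) \<le> r \<and> r \<le> eps_min N m f Or)"
    by (rule success)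
  show "expected_queries (bias_alg N m) (oracle_dim N m) Or \<le>
         ennreal (6881280 * sqrt (real N) * max 1 (ln (real N)) / eps_min N m f Or
                   * max 1 (ln (ln (1 / eps_min N m f Or))))"
    by (rule queries)
qed

end
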